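(* Let $p$ be a prime. If Kaplansky's stable finiteness conjecture holds over some field of characteristic $p$, then it holds over all fields of characteristic $p$. That is, if there is a field $\mathbb{F}$ of characteristic $p$ such that $\mathbb{F}[\Gamma]$ is stably finite for every group $\Gamma$, then $\mathbb{K}[\Gamma]$ is stably finite for every field $\mathbb{K}$ of characteristic $p$ and every group $\Gamma$.
   Context: A ring $R$ with identity is directly finite if for all $x,y\in R$, $xy=1$ implies $yx=1$. It is stably finite if the matrix ring $\mathbb{M}_d(R)$ is directly finite for every $d\ge1$. Kaplansky's stable finiteness conjecture over a field $\mathbb{F}$ asserts that the group ring $\mathbb{F}[\Gamma]$ is stably finite for every group $\Gamma$. *)

theory Defs
  imports "HOL-Computational_Algebra.Primes" "HOL-Library.FuncSet" "HOL-Algebra.Ring"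
begin

(* Same convention as CHAR('a) for type-class rings: the nonnegative generator of the ideal of
   all n with n * 1 = 0; in particular it is 0 if no positive multiple of 1 vanishes. *)
definition ring_char :: "('a, 'm) ring_scheme \<Rightarrow> nat" where
  "ring_char R = Gcd {n::nat. [n] \<cdot>\<^bsub>R\<^esub> \<one>\<^bsub>R\<^esub> = \<zero>\<^bsub>R\<^esub>}"

definition supp_on :: "('f, 'm) ring_scheme \<Rightarrow> ('g, 'n) monoid_scheme \<Rightarrow> ('g \<Rightarrow> 'f) \<Rightarrow> 'g set" where
  "supp_on F \<Gamma> f = {x \<in> carrier \<Gamma>. f x \<noteq> \<zero>\<^bsub>F\<^esub>}"

(* F[\<Gamma>]: an element \<Sum> f(x) x is its coefficient function f, extensional off the carrier of \<Gamma>.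
   The product is convolution, (f g)(x) = \<Sum> f(y) g(y^-1 x), a finite sum over the support of f. *)
definition group_ring :: "('f, 'm) ring_scheme \<Rightarrow> ('g, 'n) monoid_scheme \<Rightarrow> ('g \<Rightarrow> 'f) ring" where
  "group_ring F \<Gamma> =
    \<lparr> carrier = {f \<in> carrier \<Gamma> \<rightarrow>\<^sub>E carrier F. finite (supp_on F \<Gamma> f)},
      mult = (\<lambda>f g. \<lambda>x\<in>carrier \<Gamma>.
        \<Oplus>\<^bsub>F\<^esub>y\<in>supp_on F \<Gamma> f. f y \<otimes>\<^bsub>F\<^esub> g (inv\<^bsub>\<Gamma>\<^esub> y \<otimes>\<^bsub>\<Gamma>\<^esub> x)),
      one = (\<lambda>x\<in>carrier \<Gamma>. if x = \<one>\<^bsub>\<Gamma>\<^esub> then \<one>\<^bsub>F\<^esub> else \<zero>\<^bsub>F\<^esub>),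
      zero = (\<lambda>x\<in>carrier \<Gamma>. \<zero>\<^bsub>F\<^esub>),
      add = (\<lambda>f g. \<lambda>x\<in>carrier \<Gamma>. f x \<oplus>\<^bsub>F\<^esub> g x) \<rparr>"

(* The entry in row i and column j of a d x d matrix A is A (i, j), for i, j < d. *)
definition matrix_ring :: "nat \<Rightarrow> ('a, 'm) ring_scheme \<Rightarrow> (nat \<times> nat \<Rightarrow> 'a) ring" where
  "matrix_ring d R =
    \<lparr> carrier = {..<d} \<times> {..<d} \<rightarrow>\<^sub>E carrier R,
      mult = (\<lambda>A B. \<lambda>(i, j)\<in>{..<d} \<times> {..<d}. \<Oplus>\<^bsub>R\<^esub>k\<in>{..<d}. A (i, k) \<otimes>\<^bsub>R\<^esub> B (k, j)),
      one = (\<lambda>(i, j)\<in>{..<d} \<times> {..<d}. if i = j then \<one>\<^bsub>R\<^esub> else \<zero>\<^bsub>R\<^esub>),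
      zero = (\<lambda>(i, j)\<in>{..<d} \<times> {..<d}. \<zero>\<^bsub>R\<^esub>),
      add = (\<lambda>A B. \<lambda>(i, j)\<in>{..<d} \<times> {..<d}. A (i, j) \<oplus>\<^bsub>R\<^esub> B (i, j)) \<rparr>"

definition directly_finite :: "('a, 'm) ring_scheme \<Rightarrow> bool" where
  "directly_finite R \<longleftrightarrow>
    (\<forall>x\<in>carrier R. \<forall>y\<in>carrier R. x \<otimes>\<^bsub>R\<^esub> y = \<one>\<^bsub>R\<^esub> \<longrightarrow> y \<otimes>\<^bsub>R\<^esub> x = \<one>\<^bsub>R\<^esub>)"

definition stably_finite :: "('a, 'm) ring_scheme \<Rightarrow> bool" where
  "stably_finite R \<longleftrightarrow> (\<forall>d\<ge>1. directly_finite (matrix_ring d R))"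

(* HOL cannot quantify over types inside a formula, so "every group" means every group whose
   carrier is a set of elements of 'g; the type argument makes this dependence explicit. *)
definition kaplansky_stable_finiteness :: "'g itself \<Rightarrow> ('f, 'm) ring_scheme \<Rightarrow> bool" where
  "kaplansky_stable_finiteness TYPE('g) F \<longleftrightarrow>
    (\<forall>\<Gamma>::'g monoid. group \<Gamma> \<longrightarrow> stably_finite (group_ring F \<Gamma>))"

end

(* The order of the imports makes prime the notion on natural numbers, not the one on monoids. *)
theory Submission
  imports "HOL-Algebra.Finite_Extensions" Defs
begin

text \<open>
Stable finiteness of \<open>K[\<Gamma>]\<close> can be tested one finite set of coefficients at a time. Suppose that
\<open>A B = 1\<close> but \<open>B A \<noteq> 1\<close> for matrices over \<open>K[\<Gamma>]\<close>. If a subring \<open>D\<close> of \<open>K\<close> contains the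
finitely many coefficients of \<open>A\<close> and \<open>B\<close> together with a nonzero coefficient \<open>c\<close> of \<open>B A - 1\<close>,
and if \<open>D\<close> acts by \<open>n \<times> n\<close> matrices over a ring \<open>S\<close> in such a way that \<open>c\<close> does not act as zero,
then replacing every coefficient by its matrix gives larger matrices over \<open>S[\<Gamma>]\<close> that are
again inverse to each other on one side only. So \<open>K[\<Gamma>]\<close> is stably finite as soon as each such \<open>c\<close> is detected by a
matrix representation over some \<open>S\<close> with \<open>S[\<Gamma>]\<close> stably finite: this is
\<open>stably_finite_if_residually_represented\<close>, and the group \<open>\<Gamma>\<close> never changes.

Fix \<open>\<Gamma>\<close> and call a ring \<open>S\<close> good if \<open>S[\<Gamma>]\<close> is stably finite. The field \<open>F\<close> of the hypothesis is
good, hence so is the prime field, which embeds in \<open>F\<close> and in every field \<open>K\<close> of characteristic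
\<open>p\<close>. It remains to climb from the prime field to \<open>K\<close>. As the coefficients of \<open>A\<close>, \<open>B\<close> and
\<open>B A - 1\<close> are finite in number, it is enough that every subfield \<open>L(x)\<close> is good when the subfield
\<open>L\<close> is (\<open>stably_finite_adjoin\<close>).

A ring of finite dimension over a good field is good, by its regular representation
(\<open>stably_finite_if_finite_dimension\<close>). In particular \<open>L[X]/(f)\<close> is good for every nonconstant
\<open>f\<close>, which settles the case of an algebraic \<open>x\<close>. For a transcendental \<open>x\<close>, finitely many elements
of \<open>L(x)\<close> lie in \<open>L[x, 1/a]\<close> for a common denominator \<open>a = a(x)\<close>. In the quotient
\<open>L[X]/(a X^N - 1)\<close> the class of \<open>a\<close> has the inverse \<open>X^N\<close>, so \<open>L[x, 1/a]\<close> maps to it; and since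
\<open>a X^N - 1\<close> has degree at least \<open>N\<close>, a given nonzero polynomial survives in the quotient
once \<open>N\<close> exceeds its degree. These good quotients therefore detect every nonzero element of
\<open>L[x, 1/a]\<close>.
\<close>

section \<open>Coefficients of products in group rings and matrix rings\<close>

lemma (in abelian_monoid) finsum_swap:
  assumes "finite A" "finite B" "\<And>x y. \<lbrakk>x \<in> A; y \<in> B\<rbrakk> \<Longrightarrow> f x y \<in> carrier G"
  shows "(\<Oplus>x\<in>A. \<Oplus>y\<in>B. f x y) = (\<Oplus>y\<in>B. \<Oplus>x\<in>A. f x y)"
  using assms(1,3)
proof (induction A rule: finite_induct)
  case empty
  then show ?case by simp
next
  case (insert a A)
  have "(\<Oplus>x\<in>insert a A. \<Oplus>y\<in>B. f x y) = (\<Oplus>y\<in>B. f a y) \<oplus> (\<Oplus>y\<in>B. \<Oplus>x\<in>A. f x y)"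
    using insert by (subst finsum_insert) (auto intro!: finsum_closed)
  also have "\<dots> = (\<Oplus>y\<in>B. f a y \<oplus> (\<Oplus>x\<in>A. f x y))"
    using insert by (subst finsum_addf) (auto intro!: finsum_closed)
  also have "\<dots> = (\<Oplus>y\<in>B. \<Oplus>x\<in>insert a A. f x y)"
    using insert by (intro finsum_cong') (auto intro!: finsum_closed)
  finally show ?case .
qed

text \<open>
Turns a sum over the index set of a block matrix, with \<open>d\<close> blocks of size \<open>n\<close>, into a sum over
blocks and positions within a block.
\<close>

lemma (in abelian_monoid) finsum_blocks:
  assumes "\<And>k c. \<lbrakk>k < d; c < n\<rbrakk> \<Longrightarrow> f (k * n + c) \<in> carrier G"
  shows "(\<Oplus>k\<in>{..<d * n}. f k) = (\<Oplus>k\<in>{..<d::nat}. \<Oplus>c\<in>{..<n::nat}. f (k * n + c))"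
  using assms
proof (induction d)
  case 0
  then show ?case by simp
next
  case (Suc d)
  have im: "(\<lambda>c. d * n + c) ` {..<n} = {d * n..<Suc d * n}"
    by (simp add: lessThan_atLeast0 image_add_atLeastLessThan add.commute)
  have split: "{..<Suc d * n} = {..<d * n} \<union> {d * n..<Suc d * n}" by auto
  have closed: "f k \<in> carrier G" if "k < Suc d * n" for k
  proof -
    have n: "n > 0" using that by (cases n) auto
    have "k div n < Suc d" using that n by (simp add: div_less_iff_less_mult)
    then have "f (k div n * n + k mod n) \<in> carrier G" using n by (intro Suc.prems) simp_all
    then show ?thesis by (simp only: div_mult_mod_eq)
  qed
  have "(\<Oplus>k\<in>{..<Suc d * n}. f k) = (\<Oplus>k\<in>{..<d * n}. f k) \<oplus> (\<Oplus>k\<in>{d * n..<Suc d * n}. f k)"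
    unfolding split by (rule finsum_Un_disjoint) (auto intro!: closed)
  also have "(\<Oplus>k\<in>{d * n..<Suc d * n}. f k) = (\<Oplus>c\<in>{..<n}. f (d * n + c))"
    unfolding im[symmetric] by (rule finsum_reindex) (use Suc.prems in \<open>auto simp: inj_on_def\<close>)
  also have "(\<Oplus>k\<in>{..<d * n}. f k) = (\<Oplus>k\<in>{..<d}. \<Oplus>c\<in>{..<n}. f (k * n + c))"
    using Suc by simp
  also have "\<dots> \<oplus> (\<Oplus>c\<in>{..<n}. f (d * n + c))
      = (\<Oplus>k\<in>{..<Suc d}. \<Oplus>c\<in>{..<n}. f (k * n + c))"
    unfolding lessThan_Suc using Suc.prems
    by (subst finsum_insert) (auto intro!: finsum_closed a_comm)
  finally show ?case .
qed

lemma group_ring_apply_closed: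
  "\<lbrakk>f \<in> carrier (group_ring R \<Gamma>); x \<in> carrier \<Gamma>\<rbrakk> \<Longrightarrow> f x \<in> carrier R"
  by (auto simp: group_ring_def PiE_iff)

lemma group_ring_extensional:
  "f \<in> carrier (group_ring R \<Gamma>) \<Longrightarrow> f \<in> extensional (carrier \<Gamma>)"
  by (auto simp: group_ring_def PiE_iff)

lemma group_ring_finite_supp:
  "f \<in> carrier (group_ring R \<Gamma>) \<Longrightarrow> finite (supp_on R \<Gamma> f)"
  by (auto simp: group_ring_def PiE_iff)

lemma group_ring_memI:
  assumes "f \<in> extensional (carrier \<Gamma>)" "\<And>x. x \<in> carrier \<Gamma> \<Longrightarrow> f x \<in> carrier R"
    "finite (supp_on R \<Gamma> f)"
  shows "f \<in> carrier (group_ring R \<Gamma>)"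
  using assms by (simp add: group_ring_def PiE_iff)

lemma matrix_ring_entry:
  "\<lbrakk>A \<in> carrier (matrix_ring d R); i < d; j < d\<rbrakk> \<Longrightarrow> A (i, j) \<in> carrier R"
  by (auto simp: matrix_ring_def PiE_iff)

lemma matrix_ring_extensional:
  "A \<in> carrier (matrix_ring d R) \<Longrightarrow> A \<in> extensional ({..<d} \<times> {..<d})"
  by (auto simp: matrix_ring_def PiE_iff)

lemma matrix_ring_memI:
  assumes "A \<in> extensional ({..<d} \<times> {..<d})"
    "\<And>i j. \<lbrakk>i < d; j < d\<rbrakk> \<Longrightarrow> A (i, j) \<in> carrier R"
  shows "A \<in> carrier (matrix_ring d R)"
  using assms by (auto simp: matrix_ring_def PiE_iff)

text \<open>
The entries of a matrix product over a group ring are sums taken in the group ring; its additive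
structure is what makes it possible to read off their coefficients one group element at a time.
\<close>

lemma (in abelian_monoid) group_ring_abelian_monoid:
  "abelian_monoid (group_ring G \<Gamma>)"
proof (rule abelian_monoidI)
  let ?GR = "group_ring G \<Gamma>"
  have add: "x \<oplus>\<^bsub>?GR\<^esub> y = (\<lambda>g\<in>carrier \<Gamma>. x g \<oplus> y g)" and zero: "\<zero>\<^bsub>?GR\<^esub> = (\<lambda>g\<in>carrier \<Gamma>. \<zero>)" for x y
    by (simp_all add: group_ring_def)
  note ext = extensionalityI[of _ "carrier \<Gamma>"]
  show "x \<oplus>\<^bsub>?GR\<^esub> y \<in> carrier ?GR" if "x \<in> carrier ?GR" "y \<in> carrier ?GR" for x y
  proof (rule group_ring_memI)
    have "supp_on G \<Gamma> (x \<oplus>\<^bsub>?GR\<^esub> y) \<subseteq> supp_on G \<Gamma> x \<union> supp_on G \<Gamma> y"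
      by (auto simp: supp_on_def add)
    then show "finite (supp_on G \<Gamma> (x \<oplus>\<^bsub>?GR\<^esub> y))"
      by (rule finite_subset) (use that group_ring_finite_supp in auto)
  qed (use that group_ring_apply_closed in \<open>fastforce simp: add\<close>)+
  show "\<zero>\<^bsub>?GR\<^esub> \<in> carrier ?GR"
    by (rule group_ring_memI) (simp_all add: zero supp_on_def)
  fix x y z assume x: "x \<in> carrier ?GR" and y: "y \<in> carrier ?GR" and z: "z \<in> carrier ?GR"
  note closed = group_ring_apply_closed[OF x] group_ring_apply_closed[OF y] group_ring_apply_closed[OF z]
  show "(x \<oplus>\<^bsub>?GR\<^esub> y) \<oplus>\<^bsub>?GR\<^esub> z = x \<oplus>\<^bsub>?GR\<^esub> (y \<oplus>\<^bsub>?GR\<^esub> z)"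
    by (rule ext) (simp_all add: add a_assoc closed)
  show "\<zero>\<^bsub>?GR\<^esub> \<oplus>\<^bsub>?GR\<^esub> x = x"
    by (rule ext) (simp_all add: add zero closed group_ring_extensional[OF x])
  show "x \<oplus>\<^bsub>?GR\<^esub> y = y \<oplus>\<^bsub>?GR\<^esub> x"
    by (rule ext) (simp_all add: add a_comm closed)
qed

lemma (in abelian_monoid) group_ring_finsum_apply:
  assumes "finite A" "\<And>k. k \<in> A \<Longrightarrow> f k \<in> carrier (group_ring G \<Gamma>)" "x \<in> carrier \<Gamma>"
  shows "finsum (group_ring G \<Gamma>) f A x = (\<Oplus>k\<in>A. f k x)"
proof -
  interpret GR: abelian_monoid "group_ring G \<Gamma>" by (rule group_ring_abelian_monoid)
  show ?thesis
    using assms(1,2)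
  proof (induction A rule: finite_induct)
    case empty
    have "\<zero>\<^bsub>group_ring G \<Gamma>\<^esub> x = \<zero>" using assms(3) by (simp add: group_ring_def)
    then show ?case by simp
  next
    case (insert a A)
    have "f k x \<in> carrier G" if "k \<in> insert a A" for k
      using insert(4)[OF that] assms(3) by (rule group_ring_apply_closed)
    moreover have "finsum (group_ring G \<Gamma>) f (insert a A) = f a \<oplus>\<^bsub>group_ring G \<Gamma>\<^esub> finsum (group_ring G \<Gamma>) f A"
      using insert by (intro GR.finsum_insert) auto
    ultimately show ?case using insert assms(3) by (simp add: group_ring_def)
  qed
qed

text \<open>
The set \<open>U\<close> is free so that a single summation range can serve all entries of a matrix, and can
still serve after a representation has made some coefficients vanish.
\<close>

lemma (in ring) group_ring_mult_apply:
  assumes "group \<Gamma>" "f \<in> carrier (group_ring R \<Gamma>)" "g \<in> carrier (group_ring R \<Gamma>)" "x \<in> carrier \<Gamma>"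
    "finite U" "supp_on R \<Gamma> f \<subseteq> U" "U \<subseteq> carrier \<Gamma>"
  shows "(f \<otimes>\<^bsub>group_ring R \<Gamma>\<^esub> g) x = (\<Oplus>y\<in>U. f y \<otimes> g (inv\<^bsub>\<Gamma>\<^esub> y \<otimes>\<^bsub>\<Gamma>\<^esub> x))"
proof -
  interpret \<Gamma>: group \<Gamma> by fact
  have f: "f y \<in> carrier R" and g: "g y \<in> carrier R" if "y \<in> carrier \<Gamma>" for y
    using that assms(2,3) by (auto intro: group_ring_apply_closed)
  have "(\<Oplus>y\<in>supp_on R \<Gamma> f. f y \<otimes> g (inv\<^bsub>\<Gamma>\<^esub> y \<otimes>\<^bsub>\<Gamma>\<^esub> x))
      = (\<Oplus>y\<in>U. f y \<otimes> g (inv\<^bsub>\<Gamma>\<^esub> y \<otimes>\<^bsub>\<Gamma>\<^esub> x))"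
    by (rule add.finprod_mono_neutral_cong_left)
       (use assms f g in \<open>auto simp: supp_on_def subset_iff\<close>)
  then show ?thesis using assms(4) by (simp add: group_ring_def)
qed

lemma (in ring) group_ring_mult_closed:
  assumes "group \<Gamma>" "f \<in> carrier (group_ring R \<Gamma>)" "g \<in> carrier (group_ring R \<Gamma>)"
  shows "f \<otimes>\<^bsub>group_ring R \<Gamma>\<^esub> g \<in> carrier (group_ring R \<Gamma>)"
proof -
  interpret \<Gamma>: group \<Gamma> by fact
  let ?S = "supp_on R \<Gamma>"
  have f: "f y \<in> carrier R" and g: "g y \<in> carrier R" if "y \<in> carrier \<Gamma>" for y
    using that assms(2,3) by (auto intro: group_ring_apply_closed)
  have fin: "finite (?S f)" "finite (?S g)" using assms by (auto intro: group_ring_finite_supp)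
  have S: "?S f \<subseteq> carrier \<Gamma>" by (auto simp: supp_on_def)
  have "?S (f \<otimes>\<^bsub>group_ring R \<Gamma>\<^esub> g) \<subseteq> (\<lambda>(y, z). y \<otimes>\<^bsub>\<Gamma>\<^esub> z) ` (?S f \<times> ?S g)"
  proof
    fix x assume x: "x \<in> ?S (f \<otimes>\<^bsub>group_ring R \<Gamma>\<^esub> g)"
    then have xc: "x \<in> carrier \<Gamma>" by (simp add: supp_on_def)
    have "\<exists>y\<in>?S f. g (inv\<^bsub>\<Gamma>\<^esub> y \<otimes>\<^bsub>\<Gamma>\<^esub> x) \<noteq> \<zero>"
    proof (rule ccontr)
      assume none: "\<not> ?thesis"
      have "(\<Oplus>y\<in>?S f. f y \<otimes> g (inv\<^bsub>\<Gamma>\<^esub> y \<otimes>\<^bsub>\<Gamma>\<^esub> x)) = (\<Oplus>y\<in>?S f. \<zero>)"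
      proof (rule finsum_cong')
        fix y assume y: "y \<in> ?S f"
        then have "g (inv\<^bsub>\<Gamma>\<^esub> y \<otimes>\<^bsub>\<Gamma>\<^esub> x) = \<zero>" using none by blast
        then show "f y \<otimes> g (inv\<^bsub>\<Gamma>\<^esub> y \<otimes>\<^bsub>\<Gamma>\<^esub> x) = \<zero>" using f y S by auto
      qed simp_all
      then show False using x xc by (simp add: group_ring_def supp_on_def)
    qed
    then obtain y where y: "y \<in> ?S f" "g (inv\<^bsub>\<Gamma>\<^esub> y \<otimes>\<^bsub>\<Gamma>\<^esub> x) \<noteq> \<zero>" by blast
    moreover have "x = y \<otimes>\<^bsub>\<Gamma>\<^esub> (inv\<^bsub>\<Gamma>\<^esub> y \<otimes>\<^bsub>\<Gamma>\<^esub> x)"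
      using xc S y(1) by (subst \<Gamma>.m_assoc[symmetric]) auto
    ultimately show "x \<in> (\<lambda>(y, z). y \<otimes>\<^bsub>\<Gamma>\<^esub> z) ` (?S f \<times> ?S g)"
      using xc S by (intro image_eqI[of _ _ "(y, inv\<^bsub>\<Gamma>\<^esub> y \<otimes>\<^bsub>\<Gamma>\<^esub> x)"]) (auto simp: supp_on_def)
  qed
  then have "finite (?S (f \<otimes>\<^bsub>group_ring R \<Gamma>\<^esub> g))"
    by (rule finite_subset) (use fin in auto)
  moreover have "(f \<otimes>\<^bsub>group_ring R \<Gamma>\<^esub> g) x \<in> carrier R" if "x \<in> carrier \<Gamma>" for x
    using that S f g group_ring_mult_apply[OF assms that fin(1)] by (auto intro!: finsum_closed)
  moreover have "f \<otimes>\<^bsub>group_ring R \<Gamma>\<^esub> g \<in> extensional (carrier \<Gamma>)"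
    by (simp add: group_ring_def)
  ultimately show ?thesis by (intro group_ring_memI)
qed

lemma (in ring) matrix_group_ring_mult_closed:
  assumes "group \<Gamma>"
    and "A \<in> carrier (matrix_ring d (group_ring R \<Gamma>))" "B \<in> carrier (matrix_ring d (group_ring R \<Gamma>))"
  shows "A \<otimes>\<^bsub>matrix_ring d (group_ring R \<Gamma>)\<^esub> B \<in> carrier (matrix_ring d (group_ring R \<Gamma>))"
proof -
  interpret GR: abelian_monoid "group_ring R \<Gamma>" by (rule group_ring_abelian_monoid)
  note entry = assms(2,3)[THEN matrix_ring_entry]
  show ?thesis
    by (intro matrix_ring_memI)
       (auto simp: matrix_ring_def intro!: GR.finsum_closed group_ring_mult_closed assms(1) entry)
qed

lemma (in ring) matrix_group_ring_mult_apply: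
  assumes "group \<Gamma>"
    and "A \<in> carrier (matrix_ring d (group_ring R \<Gamma>))" "B \<in> carrier (matrix_ring d (group_ring R \<Gamma>))"
    and "i < d" "j < d" "x \<in> carrier \<Gamma>"
    and "finite U" "U \<subseteq> carrier \<Gamma>" "\<And>k. k < d \<Longrightarrow> supp_on R \<Gamma> (A (i, k)) \<subseteq> U"
  shows "(A \<otimes>\<^bsub>matrix_ring d (group_ring R \<Gamma>)\<^esub> B) (i, j) x
    = (\<Oplus>k\<in>{..<d}. \<Oplus>y\<in>U. A (i, k) y \<otimes> B (k, j) (inv\<^bsub>\<Gamma>\<^esub> y \<otimes>\<^bsub>\<Gamma>\<^esub> x))"
proof -
  interpret \<Gamma>: group \<Gamma> by fact
  have AB: "A (i, k) \<in> carrier (group_ring R \<Gamma>)" "B (k, j) \<in> carrier (group_ring R \<Gamma>)" if "k < d" for k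
    using that assms(2-5) by (auto intro: matrix_ring_entry)
  have "(A \<otimes>\<^bsub>matrix_ring d (group_ring R \<Gamma>)\<^esub> B) (i, j) x
      = (\<Oplus>k\<in>{..<d}. (A (i, k) \<otimes>\<^bsub>group_ring R \<Gamma>\<^esub> B (k, j)) x)"
    using assms(4-6) AB group_ring_mult_closed[OF assms(1)]
    by (simp add: matrix_ring_def) (subst group_ring_finsum_apply, auto)
  also have "\<dots> = (\<Oplus>k\<in>{..<d}. \<Oplus>y\<in>U. A (i, k) y \<otimes> B (k, j) (inv\<^bsub>\<Gamma>\<^esub> y \<otimes>\<^bsub>\<Gamma>\<^esub> x))"
  proof (rule finsum_cong')
    have "A (i, k) y \<in> carrier R" "B (k, j) y \<in> carrier R" if "y \<in> carrier \<Gamma>" "k < d" for y k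
      using AB[OF that(2)] that by (auto intro: group_ring_apply_closed)
    then show "(\<lambda>k. \<Oplus>y\<in>U. A (i, k) y \<otimes> B (k, j) (inv\<^bsub>\<Gamma>\<^esub> y \<otimes>\<^bsub>\<Gamma>\<^esub> x)) \<in> {..<d} \<rightarrow> carrier R"
      using assms(6,8) by (auto intro!: finsum_closed simp: subset_iff)
  qed (use assms AB in \<open>auto intro!: group_ring_mult_apply\<close>)
  finally show ?thesis .
qed

section \<open>Matrix representations and one-sided inverses\<close>

lemma block_index_less:
  assumes "i < d" "a < n"
  shows "i * n + a < d * (n::nat)"
proof -
  have "i * n + a < Suc i * n" using assms by simp
  also have "\<dots> \<le> d * n" using assms by (intro mult_le_mono1) simp
  finally show ?thesis .
qed

lemma block_index_inject:
  assumes "a < n" "b < n" "i * n + a = j * n + (b::nat)"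
  shows "i = j \<and> a = b"
proof -
  have "n > 0" using assms(1) by simp
  have "i = (i * n + a) div n" using assms(1) \<open>n > 0\<close> by simp
  also have "\<dots> = (j * n + b) div n" by (simp only: assms(3))
  also have "\<dots> = j" using assms(2) \<open>n > 0\<close> by simp
  finally have "i = j" .
  then show ?thesis using assms(3) by simp
qed

text \<open>
A unital representation of the subring \<open>D\<close> of \<open>R\<close> by \<open>n \<times> n\<close> matrices over \<open>S\<close>, where
\<open>\<rho> x a b\<close> is the entry of the matrix of \<open>x\<close> in row \<open>a\<close> and column \<open>b\<close>. For \<open>n = 1\<close> it is a
ring homomorphism; the general case also covers regular representations.
\<close>

locale matrix_representation = R: ring R + S: ring S
  for R :: "('a, 'm) ring_scheme" (structure) and D :: "'a set" and S :: "('b, 'k) ring_scheme"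
    and n :: nat and \<rho> :: "'a \<Rightarrow> nat \<Rightarrow> nat \<Rightarrow> 'b" +
  assumes subring: "subring D R" and size: "n > 0"
    and closed: "\<And>x a b. \<lbrakk>x \<in> D; a < n; b < n\<rbrakk> \<Longrightarrow> \<rho> x a b \<in> carrier S"
    and rep_add: "\<And>x y a b. \<lbrakk>x \<in> D; y \<in> D; a < n; b < n\<rbrakk> \<Longrightarrow> \<rho> (x \<oplus> y) a b = \<rho> x a b \<oplus>\<^bsub>S\<^esub> \<rho> y a b"
    and rep_mult: "\<And>x y a b. \<lbrakk>x \<in> D; y \<in> D; a < n; b < n\<rbrakk> \<Longrightarrow>
      \<rho> (x \<otimes> y) a b = (\<Oplus>\<^bsub>S\<^esub>c\<in>{..<n}. \<rho> x a c \<otimes>\<^bsub>S\<^esub> \<rho> y c b)"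
    and rep_one: "\<And>a b. \<lbrakk>a < n; b < n\<rbrakk> \<Longrightarrow> \<rho> \<one> a b = (if a = b then \<one>\<^bsub>S\<^esub> else \<zero>\<^bsub>S\<^esub>)"
begin

lemma rep_zero: "\<lbrakk>a < n; b < n\<rbrakk> \<Longrightarrow> \<rho> \<zero> a b = \<zero>\<^bsub>S\<^esub>"
  using rep_add[of \<zero> \<zero> a b] closed[of \<zero> a b] subringE(2)[OF subring]
  by (metis R.l_zero R.zero_closed S.add.l_cancel_one')

lemma rep_finsum:
  assumes "finite A" "\<And>x. x \<in> A \<Longrightarrow> f x \<in> D"
  shows finsum_in_D: "finsum R f A \<in> D"
    and "\<lbrakk>a < n; b < n\<rbrakk> \<Longrightarrow> \<rho> (finsum R f A) a b = (\<Oplus>\<^bsub>S\<^esub>x\<in>A. \<rho> (f x) a b)"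
proof -
  have "finsum R f A \<in> D \<and>
    (a < n \<longrightarrow> b < n \<longrightarrow> \<rho> (finsum R f A) a b = (\<Oplus>\<^bsub>S\<^esub>x\<in>A. \<rho> (f x) a b))"
    using assms
  proof (induction A rule: finite_induct)
    case empty
    then show ?case using rep_zero subringE(2)[OF subring] by simp
  next
    case (insert x A)
    have "f y \<in> carrier R" if "y \<in> insert x A" for y
      using that insert(4) subringE(1)[OF subring] by auto
    then have "finsum R f (insert x A) = f x \<oplus> finsum R f A"
      using insert by (intro R.finsum_insert) auto
    moreover have "(\<Oplus>\<^bsub>S\<^esub>y\<in>insert x A. \<rho> (f y) a b) = \<rho> (f x) a b \<oplus>\<^bsub>S\<^esub> (\<Oplus>\<^bsub>S\<^esub>y\<in>A. \<rho> (f y) a b)"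
      if "a < n" "b < n"
      using insert closed that by (intro S.finsum_insert) auto
    ultimately show ?case
      using insert rep_add subringE(7)[OF subring] by auto
  qed
  then show "finsum R f A \<in> D"
    and "\<lbrakk>a < n; b < n\<rbrakk> \<Longrightarrow> \<rho> (finsum R f A) a b = (\<Oplus>\<^bsub>S\<^esub>x\<in>A. \<rho> (f x) a b)"
    by simp_all
qed

text \<open>
Applying \<open>\<rho>\<close> to every coefficient gives a \<open>d \<times> d\<close> matrix of \<open>n \<times> n\<close> blocks; the
quotient of an index by \<open>n\<close> selects the block and the remainder the position within it.
\<close>

definition expand :: "('g, 'l) monoid_scheme \<Rightarrow> nat \<Rightarrow> (nat \<times> nat \<Rightarrow> 'g \<Rightarrow> 'a) \<Rightarrow> nat \<times> nat \<Rightarrow> 'g \<Rightarrow> 'b"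
  where "expand \<Gamma> d P = (\<lambda>(I, J)\<in>{..<d * n} \<times> {..<d * n}. \<lambda>g\<in>carrier \<Gamma>.
    \<rho> (P (I div n, J div n) g) (I mod n) (J mod n))"

lemma expand_apply:
  assumes "i < d" "j < d" "a < n" "b < n" "g \<in> carrier \<Gamma>"
  shows "expand \<Gamma> d P (i * n + a, j * n + b) g = \<rho> (P (i, j) g) a b"
  using assms by (simp add: expand_def block_index_less)

lemma block_index:
  assumes "I < d * n"
  obtains i a where "I = i * n + a" "i < d" "a < n"
proof
  show "I = I div n * n + I mod n" "I div n < d" "I mod n < n"
    using assms size by (simp_all add: div_less_iff_less_mult)
qed

definition "matrices_over_D \<Gamma> d = {P \<in> carrier (matrix_ring d (group_ring R \<Gamma>)).
  \<forall>i<d. \<forall>j<d. \<forall>g\<in>carrier \<Gamma>. P (i, j) g \<in> D}"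

lemma expand_closed:
  assumes "P \<in> matrices_over_D \<Gamma> d"
  shows "expand \<Gamma> d P \<in> carrier (matrix_ring (d * n) (group_ring S \<Gamma>))"
proof -
  have "expand \<Gamma> d P (I, J) \<in> carrier (group_ring S \<Gamma>)" if IJ: "I < d * n" "J < d * n" for I J
  proof -
    obtain i a where I: "I = i * n + a" "i < d" "a < n"
      by (rule block_index[OF IJ(1)])
    obtain j b where J: "J = j * n + b" "j < d" "b < n"
      by (rule block_index[OF IJ(2)])
    have "P (i, j) \<in> carrier (group_ring R \<Gamma>)"
      using assms I J by (auto simp: matrices_over_D_def intro: matrix_ring_entry)
    then have "finite (supp_on R \<Gamma> (P (i, j)))" by (rule group_ring_finite_supp)
    moreover have "supp_on S \<Gamma> (expand \<Gamma> d P (I, J)) \<subseteq> supp_on R \<Gamma> (P (i, j))"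
      using I J rep_zero by (auto simp: supp_on_def expand_apply)
    ultimately have "finite (supp_on S \<Gamma> (expand \<Gamma> d P (I, J)))" by (rule rev_finite_subset)
    moreover have "expand \<Gamma> d P (I, J) g \<in> carrier S" if "g \<in> carrier \<Gamma>" for g
      using assms I J that closed by (auto simp: expand_apply matrices_over_D_def)
    moreover have "expand \<Gamma> d P (I, J) \<in> extensional (carrier \<Gamma>)"
      using IJ by (simp add: expand_def)
    ultimately show ?thesis by (intro group_ring_memI)
  qed
  then show ?thesis by (intro matrix_ring_memI) (simp_all add: expand_def)
qed

lemma expand_eqI:
  assumes "Q \<in> carrier (matrix_ring (d * n) (group_ring S \<Gamma>))"
    "\<And>i j a b g. \<lbrakk>i < d; j < d; a < n; b < n; g \<in> carrier \<Gamma>\<rbrakk> \<Longrightarrow>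
      Q (i * n + a, j * n + b) g = \<rho> (P (i, j) g) a b"
  shows "Q = expand \<Gamma> d P"
proof -
  have "Q (I, J) = expand \<Gamma> d P (I, J)" if IJ: "I < d * n" "J < d * n" for I J
  proof -
    have "Q (I, J) \<in> extensional (carrier \<Gamma>)"
      using matrix_ring_entry[OF assms(1) IJ] by (rule group_ring_extensional)
    moreover have "expand \<Gamma> d P (I, J) \<in> extensional (carrier \<Gamma>)"
      using IJ by (simp add: expand_def)
    moreover have "Q (I, J) g = expand \<Gamma> d P (I, J) g" if g: "g \<in> carrier \<Gamma>" for g
    proof -
      obtain i a where I: "I = i * n + a" "i < d" "a < n"
        by (rule block_index[OF IJ(1)])
      obtain j b where J: "J = j * n + b" "j < d" "b < n"
        by (rule block_index[OF IJ(2)])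
      show ?thesis
        using assms(2) I J g by (simp add: expand_apply)
    qed
    ultimately show ?thesis by (rule extensionalityI)
  qed
  moreover have "Q \<in> extensional ({..<d * n} \<times> {..<d * n})"
    using assms(1) by (rule matrix_ring_extensional)
  ultimately show ?thesis
    by (intro extensionalityI[of Q "{..<d * n} \<times> {..<d * n}"]) (auto simp: expand_def)
qed

text \<open>
Both products are, coefficientwise, double sums over matrix indices and over a finite set \<open>U\<close> of
group elements. Splitting the index of the larger matrix into a block and a position, the sum over
positions is the matrix product of \<open>\<rho>\<close>-values and collapses by multiplicativity of \<open>\<rho>\<close>.
\<close>

lemma matrices_over_D_mult:
  assumes "group \<Gamma>" "P \<in> matrices_over_D \<Gamma> d" "Q \<in> matrices_over_D \<Gamma> d"
  defines "M \<equiv> matrix_ring d (group_ring R \<Gamma>)"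
  shows "P \<otimes>\<^bsub>M\<^esub> Q \<in> matrices_over_D \<Gamma> d"
    and "expand \<Gamma> d (P \<otimes>\<^bsub>M\<^esub> Q) = expand \<Gamma> d P \<otimes>\<^bsub>matrix_ring (d * n) (group_ring S \<Gamma>)\<^esub> expand \<Gamma> d Q"
proof -
  interpret \<Gamma>: group \<Gamma> by fact
  note [simp] = \<Gamma>.inv_closed \<Gamma>.m_closed
  have XY: "P \<in> carrier M" "Q \<in> carrier M" using assms by (auto simp: matrices_over_D_def)
  have XYG: "P (i, j) \<in> carrier (group_ring R \<Gamma>)" "Q (i, j) \<in> carrier (group_ring R \<Gamma>)"
    if "i < d" "j < d" for i j using XY that by (auto simp: M_def intro: matrix_ring_entry)
  have XYD: "P (i, j) g \<in> D" "Q (i, j) g \<in> D" if "i < d" "j < d" "g \<in> carrier \<Gamma>" for i j g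
    using that assms by (auto simp: matrices_over_D_def)
  define U where "U = (\<Union>i\<in>{..<d}. \<Union>j\<in>{..<d}. supp_on R \<Gamma> (P (i, j)))"
  have U: "finite U" "U \<subseteq> carrier \<Gamma>"
    using XYG by (auto simp: U_def supp_on_def intro: group_ring_finite_supp[unfolded supp_on_def])
  have UX: "supp_on R \<Gamma> (P (i, j)) \<subseteq> U" if "i < d" "j < d" for i j
    using that by (auto simp: U_def)
  have prod: "(P \<otimes>\<^bsub>M\<^esub> Q) (i, j) x = (\<Oplus>k\<in>{..<d}. \<Oplus>y\<in>U. P (i, k) y \<otimes> Q (k, j) (inv\<^bsub>\<Gamma>\<^esub> y \<otimes>\<^bsub>\<Gamma>\<^esub> x))"
    if "i < d" "j < d" "x \<in> carrier \<Gamma>" for i j x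
    unfolding M_def using XY U UX that assms(1)
    by (intro R.matrix_group_ring_mult_apply) (auto simp: M_def)
  have coef: "P (i, k) y \<otimes> Q (k, j) (inv\<^bsub>\<Gamma>\<^esub> y \<otimes>\<^bsub>\<Gamma>\<^esub> x) \<in> D"
    if "i < d" "j < d" "k < d" "y \<in> U" "x \<in> carrier \<Gamma>" for i j k x y
    using that U(2) by (intro subringE(6)[OF subring] XYD) auto
  have inner: "(\<Oplus>y\<in>U. P (i, k) y \<otimes> Q (k, j) (inv\<^bsub>\<Gamma>\<^esub> y \<otimes>\<^bsub>\<Gamma>\<^esub> x)) \<in> D"
    if "i < d" "j < d" "k < d" "x \<in> carrier \<Gamma>" for i j k x
    using U(1) coef[OF that(1-3) _ that(4)] by (rule finsum_in_D)
  have sumD: "(P \<otimes>\<^bsub>M\<^esub> Q) (i, j) x \<in> D" if "i < d" "j < d" "x \<in> carrier \<Gamma>" for i j x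
    unfolding prod[OF that]
    by (rule finsum_in_D[OF finite_lessThan]) (use inner that in auto)
  have "P \<otimes>\<^bsub>M\<^esub> Q \<in> carrier M"
    unfolding M_def using assms(1) XY by (intro R.matrix_group_ring_mult_closed) (simp_all add: M_def)
  then show *: "P \<otimes>\<^bsub>M\<^esub> Q \<in> matrices_over_D \<Gamma> d"
    using sumD by (auto simp: matrices_over_D_def M_def)
  let ?P = "expand \<Gamma> d P" and ?Q = "expand \<Gamma> d Q" and ?N = "matrix_ring (d * n) (group_ring S \<Gamma>)"
  have XY': "?P \<in> carrier ?N" "?Q \<in> carrier ?N" using assms expand_closed by auto
  have UX': "supp_on S \<Gamma> (?P (I, J)) \<subseteq> U" if IJ: "I < d * n" "J < d * n" for I J
  proof -
    obtain i a where I: "I = i * n + a" "i < d" "a < n"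
      by (rule block_index[OF IJ(1)])
    obtain j b where J: "J = j * n + b" "j < d" "b < n"
      by (rule block_index[OF IJ(2)])
    show ?thesis
      using I J rep_zero UX[OF I(2) J(2)] by (auto simp: supp_on_def expand_apply subset_iff)
  qed
  have "?P \<otimes>\<^bsub>?N\<^esub> ?Q = expand \<Gamma> d (P \<otimes>\<^bsub>M\<^esub> Q)"
  proof (rule expand_eqI)
    show "?P \<otimes>\<^bsub>?N\<^esub> ?Q \<in> carrier ?N"
      using assms(1) XY' by (rule S.matrix_group_ring_mult_closed)
  next
    fix i j a b g assume ij: "i < d" "j < d" and ab: "a < n" "b < n" and g: "g \<in> carrier \<Gamma>"
    let ?t = "\<lambda>k y c. \<rho> (P (i, k) y) a c \<otimes>\<^bsub>S\<^esub> \<rho> (Q (k, j) (inv\<^bsub>\<Gamma>\<^esub> y \<otimes>\<^bsub>\<Gamma>\<^esub> g)) c b"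
    have t: "?t k y c \<in> carrier S" if "k < d" "y \<in> U" "c < n" for k y c
      using that ij ab g U(2) by (intro S.m_closed closed XYD) auto
    let ?F = "\<lambda>K y. ?P (i * n + a, K) y \<otimes>\<^bsub>S\<^esub> ?Q (K, j * n + b) (inv\<^bsub>\<Gamma>\<^esub> y \<otimes>\<^bsub>\<Gamma>\<^esub> g)"
    have F: "?F (k * n + c) y = ?t k y c" if "k < d" "y \<in> U" "c < n" for k y c
      using that ij ab g U(2) by (subst (1 2) expand_apply) auto
    have F': "(\<Oplus>\<^bsub>S\<^esub>y\<in>U. ?F (k * n + c) y) = (\<Oplus>\<^bsub>S\<^esub>y\<in>U. ?t k y c)" if "k < d" "c < n" for k c
      using that t F by (intro S.finsum_cong') auto
    have Fc: "(\<Oplus>\<^bsub>S\<^esub>y\<in>U. ?F (k * n + c) y) \<in> carrier S" if "k < d" "c < n" for k c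
      unfolding F'[OF that] using that t by (intro S.finsum_closed) auto
    have "(?P \<otimes>\<^bsub>?N\<^esub> ?Q) (i * n + a, j * n + b) g = (\<Oplus>\<^bsub>S\<^esub>K\<in>{..<d * n}. \<Oplus>\<^bsub>S\<^esub>y\<in>U. ?F K y)"
      using XY' U UX' assms(1) ij ab g block_index_less by (intro S.matrix_group_ring_mult_apply) auto
    also have "\<dots> = (\<Oplus>\<^bsub>S\<^esub>k\<in>{..<d}. \<Oplus>\<^bsub>S\<^esub>c\<in>{..<n}. \<Oplus>\<^bsub>S\<^esub>y\<in>U. ?F (k * n + c) y)"
      using Fc by (rule S.finsum_blocks)
    also have "\<dots> = (\<Oplus>\<^bsub>S\<^esub>k\<in>{..<d}. \<Oplus>\<^bsub>S\<^esub>c\<in>{..<n}. \<Oplus>\<^bsub>S\<^esub>y\<in>U. ?t k y c)"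
      using F F' t by (intro S.finsum_cong' refl) (auto intro!: S.finsum_closed)
    also have "\<dots> = (\<Oplus>\<^bsub>S\<^esub>k\<in>{..<d}. \<Oplus>\<^bsub>S\<^esub>y\<in>U. \<Oplus>\<^bsub>S\<^esub>c\<in>{..<n}. ?t k y c)"
      using t U by (intro S.finsum_cong' refl S.finsum_swap) (auto intro!: S.finsum_closed)
    also have "\<dots> = (\<Oplus>\<^bsub>S\<^esub>k\<in>{..<d}. \<Oplus>\<^bsub>S\<^esub>y\<in>U. \<rho> (P (i, k) y \<otimes> Q (k, j) (inv\<^bsub>\<Gamma>\<^esub> y \<otimes>\<^bsub>\<Gamma>\<^esub> g)) a b)"
      using ij ab g U(2) coef closed
      by (intro S.finsum_cong' refl rep_mult[symmetric] XYD) (auto intro!: S.finsum_closed)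
    also have "\<dots> = (\<Oplus>\<^bsub>S\<^esub>k\<in>{..<d}. \<rho> (\<Oplus>y\<in>U. P (i, k) y \<otimes> Q (k, j) (inv\<^bsub>\<Gamma>\<^esub> y \<otimes>\<^bsub>\<Gamma>\<^esub> g)) a b)"
      using coef ij g inner closed ab U(1)
      by (intro S.finsum_cong' refl rep_finsum(2)[symmetric]) auto
    also have "\<dots> = \<rho> ((P \<otimes>\<^bsub>M\<^esub> Q) (i, j) g) a b"
      unfolding prod[OF ij g]
      by (rule rep_finsum(2)[OF finite_lessThan, symmetric]) (use inner ij g ab in auto)
    finally show "(?P \<otimes>\<^bsub>?N\<^esub> ?Q) (i * n + a, j * n + b) g = \<rho> ((P \<otimes>\<^bsub>M\<^esub> Q) (i, j) g) a b" .
  qed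
  then show "expand \<Gamma> d (P \<otimes>\<^bsub>M\<^esub> Q) = ?P \<otimes>\<^bsub>?N\<^esub> ?Q" by simp
qed

lemma expand_one:
  assumes "group \<Gamma>"
  shows "expand \<Gamma> d \<one>\<^bsub>matrix_ring d (group_ring R \<Gamma>)\<^esub> = \<one>\<^bsub>matrix_ring (d * n) (group_ring S \<Gamma>)\<^esub>"
proof (rule expand_eqI[symmetric])
  interpret \<Gamma>: group \<Gamma> by fact
  have "supp_on S \<Gamma> \<one>\<^bsub>group_ring S \<Gamma>\<^esub> \<subseteq> {\<one>\<^bsub>\<Gamma>\<^esub>}"
    by (auto simp: supp_on_def group_ring_def)
  then have "finite (supp_on S \<Gamma> \<one>\<^bsub>group_ring S \<Gamma>\<^esub>)" by (rule finite_subset) simp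
  moreover have "supp_on S \<Gamma> \<zero>\<^bsub>group_ring S \<Gamma>\<^esub> = {}"
    by (auto simp: supp_on_def group_ring_def)
  ultimately show "\<one>\<^bsub>matrix_ring (d * n) (group_ring S \<Gamma>)\<^esub> \<in> carrier (matrix_ring (d * n) (group_ring S \<Gamma>))"
    by (auto simp: matrix_ring_def group_ring_def)
next
  fix i j a b g assume ij: "i < d" "j < d" and ab: "a < n" "b < n" and g: "g \<in> carrier \<Gamma>"
  have "i * n + a = j * n + b \<longleftrightarrow> i = j \<and> a = b"
    using block_index_inject[OF ab] by blast
  then show "\<one>\<^bsub>matrix_ring (d * n) (group_ring S \<Gamma>)\<^esub> (i * n + a, j * n + b) g =
      \<rho> (\<one>\<^bsub>matrix_ring d (group_ring R \<Gamma>)\<^esub> (i, j) g) a b"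
    using ij ab g block_index_less rep_one rep_zero by (auto simp: matrix_ring_def group_ring_def)
qed

text \<open>
A one-sided inverse over \<open>R[\<Gamma>]\<close> expands to a one-sided inverse over \<open>S[\<Gamma>]\<close>, which is
two-sided there; hence \<open>\<rho>\<close> cannot see the difference between \<open>Q P\<close> and \<open>1\<close>.
\<close>

lemma one_sided_inverse_defect_killed:
  assumes "group \<Gamma>" "stably_finite (group_ring S \<Gamma>)"
    and "P \<in> matrices_over_D \<Gamma> d" "Q \<in> matrices_over_D \<Gamma> d"
  defines "M \<equiv> matrix_ring d (group_ring R \<Gamma>)"
  assumes "P \<otimes>\<^bsub>M\<^esub> Q = \<one>\<^bsub>M\<^esub>" "i < d" "j < d" "g \<in> carrier \<Gamma>" "a < n" "b < n"
  shows "\<rho> ((Q \<otimes>\<^bsub>M\<^esub> P) (i, j) g) a b = \<rho> (\<one>\<^bsub>M\<^esub> (i, j) g) a b"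
proof -
  let ?N = "matrix_ring (d * n) (group_ring S \<Gamma>)"
  have "d * n \<ge> 1" using assms(7) size by (cases d) auto
  then have "directly_finite ?N"
    using assms(2) by (auto simp: stably_finite_def)
  moreover have "expand \<Gamma> d P \<otimes>\<^bsub>?N\<^esub> expand \<Gamma> d Q = \<one>\<^bsub>?N\<^esub>"
    using matrices_over_D_mult(2)[OF assms(1,3,4)] expand_one[OF assms(1), of d] assms(6)
    by (simp add: M_def)
  ultimately have "expand \<Gamma> d Q \<otimes>\<^bsub>?N\<^esub> expand \<Gamma> d P = \<one>\<^bsub>?N\<^esub>"
    using expand_closed[OF assms(3)] expand_closed[OF assms(4)]
    unfolding directly_finite_def by blast
  then have "expand \<Gamma> d (Q \<otimes>\<^bsub>M\<^esub> P) = expand \<Gamma> d \<one>\<^bsub>M\<^esub>"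
    using matrices_over_D_mult(2)[OF assms(1,4,3)] expand_one[OF assms(1), of d]
    by (simp add: M_def)
  from this[THEN fun_cong, THEN fun_cong, of "(i * n + a, j * n + b)" g]
  show ?thesis using assms(7-) by (simp add: expand_apply)
qed

end

text \<open>
If \<open>P Q = 1\<close> and \<open>Q P \<noteq> 1\<close>, some coefficient \<open>c\<close> of \<open>Q P - 1\<close> is nonzero. The hypothesis is
applied to \<open>c\<close> together with the finitely many nonzero coefficients of \<open>P\<close> and \<open>Q\<close>, and the
representation that it provides both kills and does not kill \<open>c\<close>.
\<close>

lemma stably_finite_if_residually_represented:
  fixes R :: "('a, 'm) ring_scheme"
  assumes "ring R" "group \<Gamma>"
    and res: "\<And>C c. \<lbrakk>finite C; C \<subseteq> carrier R; c \<in> C; c \<noteq> \<zero>\<^bsub>R\<^esub>\<rbrakk> \<Longrightarrow>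
      \<exists>D n \<rho> (S :: ('b, 'k) ring_scheme). matrix_representation R D S n \<rho> \<and> stably_finite (group_ring S \<Gamma>) \<and>
        C \<subseteq> D \<and> (\<exists>a<n. \<exists>b<n. \<rho> c a b \<noteq> \<zero>\<^bsub>S\<^esub>)"
  shows "stably_finite (group_ring R \<Gamma>)"
  unfolding stably_finite_def directly_finite_def
proof (intro allI ballI impI)
  interpret R: ring R by fact
  interpret \<Gamma>: group \<Gamma> by fact
  fix d :: nat and P Q
  let ?M = "matrix_ring d (group_ring R \<Gamma>)"
  assume P: "P \<in> carrier ?M" and Q: "Q \<in> carrier ?M" and XY: "P \<otimes>\<^bsub>?M\<^esub> Q = \<one>\<^bsub>?M\<^esub>"
  have "(Q \<otimes>\<^bsub>?M\<^esub> P) (i, j) = \<one>\<^bsub>?M\<^esub> (i, j)" if ij: "i < d" "j < d" for i j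
  proof (rule extensionalityI)
    have QP: "(Q \<otimes>\<^bsub>?M\<^esub> P) (i, j) \<in> carrier (group_ring R \<Gamma>)"
      using R.matrix_group_ring_mult_closed[OF assms(2) Q P] ij by (rule matrix_ring_entry)
    then show "(Q \<otimes>\<^bsub>?M\<^esub> P) (i, j) \<in> extensional (carrier \<Gamma>)"
      by (rule group_ring_extensional)
    show "\<one>\<^bsub>?M\<^esub> (i, j) \<in> extensional (carrier \<Gamma>)"
      using ij by (simp add: matrix_ring_def group_ring_def)
    fix g assume g: "g \<in> carrier \<Gamma>"
    define u v where "u = (Q \<otimes>\<^bsub>?M\<^esub> P) (i, j) g" and "v = \<one>\<^bsub>?M\<^esub> (i, j) g"
    have u: "u \<in> carrier R" unfolding u_def using QP g by (rule group_ring_apply_closed)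
    have v: "v \<in> {\<zero>\<^bsub>R\<^esub>, \<one>\<^bsub>R\<^esub>}" using ij g by (simp add: v_def matrix_ring_def group_ring_def)
    then have v': "v \<in> carrier R" by auto
    show "u = v"
    proof (rule ccontr)
      assume "u \<noteq> v"
      define c where "c = u \<ominus>\<^bsub>R\<^esub> v"
      have c: "c \<in> carrier R" "c \<noteq> \<zero>\<^bsub>R\<^esub>" "c \<oplus>\<^bsub>R\<^esub> v = u"
        using u v' \<open>u \<noteq> v\<close> by (simp_all add: c_def R.minus_eq R.a_assoc R.l_neg)
          (metis R.minus_eq R.r_right_minus_eq)
      \<comment> \<open>the nonzero coefficients of the entries of a matrix \<open>Z\<close>\<close>
      define E where "E Z = (\<Union>i\<in>{..<d}. \<Union>j\<in>{..<d}. Z (i, j) ` supp_on R \<Gamma> (Z (i, j)))" for Z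
      have E: "finite (E Z)" "E Z \<subseteq> carrier R" if "Z \<in> carrier ?M" for Z
        using matrix_ring_entry[OF that, THEN group_ring_finite_supp]
          group_ring_apply_closed[OF matrix_ring_entry[OF that]]
        by (auto simp: E_def) (simp add: supp_on_def)
      obtain D n \<rho> and S :: "('b, 'k) ring_scheme" and a b where
        rep: "matrix_representation R D S n \<rho>" and S: "stably_finite (group_ring S \<Gamma>)"
        and D: "insert c (E P \<union> E Q) \<subseteq> D"
        and ab: "a < n" "b < n" "\<rho> c a b \<noteq> \<zero>\<^bsub>S\<^esub>"
        using res[of "insert c (E P \<union> E Q)" c] E[OF P] E[OF Q] c(1,2) by (auto 0 3)
      interpret rep: matrix_representation R D S n \<rho> by (fact rep)
      note D01 = subringE(2,3)[OF rep.subring]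
      have "Z (i, j) g \<in> D" if "Z \<in> {P, Q}" "i < d" "j < d" "g \<in> carrier \<Gamma>" for Z i j g
      proof -
        have "Z (i, j) g = \<zero>\<^bsub>R\<^esub> \<or> Z (i, j) g \<in> E Z"
          using that(2-4) unfolding E_def supp_on_def by blast
        then show ?thesis using that(1) D D01 by auto
      qed
      then have "P \<in> rep.matrices_over_D \<Gamma> d" "Q \<in> rep.matrices_over_D \<Gamma> d"
        using P Q by (auto simp: rep.matrices_over_D_def)
      then have "\<rho> u a b = \<rho> v a b"
        unfolding u_def v_def using assms(2) S XY ij g ab by (intro rep.one_sided_inverse_defect_killed)
      moreover have "\<rho> u a b = \<rho> c a b \<oplus>\<^bsub>S\<^esub> \<rho> v a b"
        using c(3) rep.rep_add[of c v a b] D D01 v ab by auto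
      ultimately show False
        using ab rep.closed[of c a b] rep.closed[of v a b] D D01 v
        by (auto dest!: sym[of "\<rho> v a b"])
    qed
  qed
  moreover have "Q \<otimes>\<^bsub>?M\<^esub> P \<in> extensional ({..<d} \<times> {..<d})" "\<one>\<^bsub>?M\<^esub> \<in> extensional ({..<d} \<times> {..<d})"
    by (simp_all add: matrix_ring_def)
  ultimately show "Q \<otimes>\<^bsub>?M\<^esub> P = \<one>\<^bsub>?M\<^esub>"
    by (intro extensionalityI[of _ "{..<d} \<times> {..<d}"]) auto
qed

section \<open>Residual detection and finite free extensions\<close>

lemma stably_finite_if_residual_homs:
  fixes R :: "('a, 'm) ring_scheme"
  assumes "ring R" "group \<Gamma>"
    and res: "\<And>C c. \<lbrakk>finite C; C \<subseteq> carrier R; c \<in> C; c \<noteq> \<zero>\<^bsub>R\<^esub>\<rbrakk> \<Longrightarrow>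
      \<exists>D \<phi> (S :: ('b, 'k) ring_scheme). subring D R \<and> ring S \<and> \<phi> \<in> ring_hom (R\<lparr>carrier := D\<rparr>) S \<and>
        stably_finite (group_ring S \<Gamma>) \<and> C \<subseteq> D \<and> \<phi> c \<noteq> \<zero>\<^bsub>S\<^esub>"
  shows "stably_finite (group_ring R \<Gamma>)"
proof (rule stably_finite_if_residually_represented[OF assms(1,2)])
  fix C c assume "finite C" "C \<subseteq> carrier R" "c \<in> C" "c \<noteq> \<zero>\<^bsub>R\<^esub>"
  then obtain D \<phi> and S :: "('b, 'k) ring_scheme" where D: "subring D R" "ring S"
    and hom: "\<phi> \<in> ring_hom (R\<lparr>carrier := D\<rparr>) S"
    and S: "stably_finite (group_ring S \<Gamma>)" "C \<subseteq> D" "\<phi> c \<noteq> \<zero>\<^bsub>S\<^esub>"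
    using res by meson
  have hom: "\<And>x. x \<in> D \<Longrightarrow> \<phi> x \<in> carrier S"
    "\<And>x y. \<lbrakk>x \<in> D; y \<in> D\<rbrakk> \<Longrightarrow> \<phi> (x \<otimes>\<^bsub>R\<^esub> y) = \<phi> x \<otimes>\<^bsub>S\<^esub> \<phi> y"
    "\<And>x y. \<lbrakk>x \<in> D; y \<in> D\<rbrakk> \<Longrightarrow> \<phi> (x \<oplus>\<^bsub>R\<^esub> y) = \<phi> x \<oplus>\<^bsub>S\<^esub> \<phi> y" "\<phi> \<one>\<^bsub>R\<^esub> = \<one>\<^bsub>S\<^esub>"
    using ring_hom_memE[OF hom] by simp_all
  have "matrix_representation R D S 1 (\<lambda>x a b. \<phi> x)"
  proof -
    interpret S: ring S by fact
    show ?thesis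
      by (intro matrix_representation.intro matrix_representation_axioms.intro)
         (simp_all add: assms(1) D hom lessThan_Suc)
  qed
  then show "\<exists>D n \<rho> (S :: ('b, 'k) ring_scheme). matrix_representation R D S n \<rho> \<and>
      stably_finite (group_ring S \<Gamma>) \<and> C \<subseteq> D \<and> (\<exists>a<n. \<exists>b<n. \<rho> c a b \<noteq> \<zero>\<^bsub>S\<^esub>)"
    using S by (intro exI[of _ D] exI[of _ "1::nat"] exI[of _ "\<lambda>x a b. \<phi> x"] exI[of _ S]) auto
qed

lemma stably_finite_if_embeds:
  fixes R :: "('a, 'm) ring_scheme" and S :: "('b, 'k) ring_scheme"
  assumes "ring R" "ring S" "group \<Gamma>" "\<phi> \<in> ring_hom R S"
    and "\<And>x. \<lbrakk>x \<in> carrier R; \<phi> x = \<zero>\<^bsub>S\<^esub>\<rbrakk> \<Longrightarrow> x = \<zero>\<^bsub>R\<^esub>"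
    and "stably_finite (group_ring S \<Gamma>)"
  shows "stably_finite (group_ring R \<Gamma>)"
proof (rule stably_finite_if_residual_homs[OF assms(1,3)])
  fix C c assume "C \<subseteq> carrier R" "c \<in> C" "c \<noteq> \<zero>\<^bsub>R\<^esub>"
  then show "\<exists>D \<phi> (S :: ('b, 'k) ring_scheme). subring D R \<and> ring S \<and> \<phi> \<in> ring_hom (R\<lparr>carrier := D\<rparr>) S \<and>
        stably_finite (group_ring S \<Gamma>) \<and> C \<subseteq> D \<and> \<phi> c \<noteq> \<zero>\<^bsub>S\<^esub>"
    using assms ring.carrier_is_subring[OF assms(1)]
    by (intro exI[of _ "carrier R"] exI[of _ \<phi>] exI[of _ S]) auto
qed

context ring
begin

lemma finsum_subring:
  assumes "subring D R" "f \<in> A \<rightarrow> D"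
  shows "finsum (R\<lparr>carrier := D\<rparr>) f A = finsum R f A"
proof -
  interpret D: ring "R\<lparr>carrier := D\<rparr>" by (rule subring_is_ring[OF assms(1)])
  have f: "f \<in> A \<rightarrow> carrier R" using assms(2) subringE(1)[OF assms(1)] by auto
  show ?thesis
    using assms(2) f
  proof (induction A rule: infinite_finite_induct)
    case (insert x A)
    have "finsum (R\<lparr>carrier := D\<rparr>) f (insert x A) = f x \<oplus> finsum (R\<lparr>carrier := D\<rparr>) f A"
      using D.finsum_insert[of A x f] insert by (auto simp: Pi_iff)
    moreover have "finsum R f (insert x A) = f x \<oplus> finsum R f A"
      using insert by (intro finsum_insert) (auto simp: Pi_iff)
    ultimately show ?case using insert by (auto simp: Pi_iff)
  next
    case (infinite A)
    then show ?case using D.finsum_infinite[of A f] by simp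
  next
    case empty
    then show ?case using D.finsum_empty[of f] by simp
  qed
qed

lemma combine_eq_finsum:
  assumes "length Ks = length Us" "set Ks \<subseteq> carrier R" "set Us \<subseteq> carrier R"
  shows "combine Ks Us = (\<Oplus>i\<in>{..<length Us}. Ks ! i \<otimes> Us ! i)"
  using assms
proof (induction Ks Us rule: list_induct2)
  case Nil
  then show ?case by simp
next
  case (Cons k Ks u Us)
  have in_carrier: "Ks ! i \<otimes> Us ! i \<in> carrier R" if "i < length Us" for i
    using Cons that by (auto simp: subset_iff)
  have "(\<Oplus>i\<in>{..<length (u # Us)}. (k # Ks) ! i \<otimes> (u # Us) ! i)
      = k \<otimes> u \<oplus> (\<Oplus>i\<in>Suc ` {..<length Us}. (k # Ks) ! i \<otimes> (u # Us) ! i)"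
    using Cons.prems in_carrier by (simp add: lessThan_Suc_eq_insert_0) (subst finsum_insert, auto)
  also have "(\<Oplus>i\<in>Suc ` {..<length Us}. (k # Ks) ! i \<otimes> (u # Us) ! i)
      = (\<Oplus>i\<in>{..<length Us}. Ks ! i \<otimes> Us ! i)"
    using in_carrier by (subst finsum_reindex) auto
  finally show ?case using Cons by simp
qed

text \<open>
The regular representation. For an \<open>L\<close>-basis \<open>v\<close> of \<open>R\<close>, right multiplication by \<open>x\<close> is
\<open>L\<close>-linear on the left \<open>L\<close>-module \<open>R\<close>, and row \<open>a\<close> of its matrix holds the coordinates of
\<open>v a x\<close>. Coordinates in rows and multiplication on the right make the representation
multiplicative rather than antimultiplicative. Faithfulness holds
since \<open>1\<close> is a combination of the \<open>v a\<close>.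
\<close>

theorem stably_finite_if_finite_dimension:
  assumes L: "subfield L R" and dim: "dimension n L (carrier R)" and ne: "\<one> \<noteq> \<zero>"
    and \<Gamma>: "group \<Gamma>" and fin: "stably_finite (group_ring (R\<lparr>carrier := L\<rparr>) \<Gamma>)"
  shows "stably_finite (group_ring R \<Gamma>)"
proof -
  let ?L = "R\<lparr>carrier := L\<rparr>"
  note Lsub = subfieldE(1)[OF L]
  interpret L: ring ?L by (rule subring_is_ring[OF Lsub])
  have Lc: "k \<in> carrier R" if "k \<in> L" for k using that subringE(1)[OF Lsub] by auto
  obtain Vs where Vs: "set Vs \<subseteq> carrier R" "independent L Vs" "length Vs = n" "Span L Vs = carrier R"
    using exists_base[OF L dim] by blast
  define v where "v i = Vs ! i" for i
  have v: "v i \<in> carrier R" if "i < n" for i using that Vs(1,3) by (auto simp: v_def)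
  have uniq: "\<exists>!Ks. set Ks \<subseteq> L \<and> length Ks = n \<and> x = combine Ks Vs" if "x \<in> carrier R" for x
    using unique_decomposition[OF L Vs(2), of x] that Vs(3,4) by simp
  define co where "co x = (THE Ks. set Ks \<subseteq> L \<and> length Ks = n \<and> x = combine Ks Vs)" for x
  have co: "set (co x) \<subseteq> L" "length (co x) = n" "x = combine (co x) Vs" if "x \<in> carrier R" for x
    using theI'[OF uniq[OF that]] unfolding co_def by auto
  have coL: "co x ! b \<in> L" if "x \<in> carrier R" "b < n" for x b
    using co[OF that(1)] that(2) by auto
  have expansion: "x = (\<Oplus>b\<in>{..<n}. co x ! b \<otimes> v b)" if "x \<in> carrier R" for x
    using combine_eq_finsum[of "co x" Vs] co[OF that] Vs Lc by (auto simp: v_def)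
  have coI: "co x ! b = k b" if "x = (\<Oplus>b\<in>{..<n}. k b \<otimes> v b)" "\<And>b. b < n \<Longrightarrow> k b \<in> L" "b < n" for x k b
  proof -
    define Ks where "Ks = map k [0..<n]"
    have Ks: "set Ks \<subseteq> L" "length Ks = n" using that(2) by (auto simp: Ks_def)
    have "(\<Oplus>i\<in>{..<n}. Ks ! i \<otimes> Vs ! i) = (\<Oplus>b\<in>{..<n}. k b \<otimes> v b)"
      using that(2) v Lc by (intro finsum_cong') (auto simp: Ks_def v_def)
    then have x: "x = combine Ks Vs"
      using combine_eq_finsum[of Ks Vs] Ks Vs(1,3) Lc that(1) by (simp add: subset_iff)
    have "x \<in> carrier R" unfolding that(1) using that(2) v Lc by (auto intro!: finsum_closed)
    then have "co x = Ks"
      unfolding co_def using uniq x Ks by (intro the1_equality) auto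
    then show ?thesis using that(3) by (simp add: Ks_def)
  qed
  define \<rho> where "\<rho> x a b = co (v a \<otimes> x) ! b" for x a b
  have \<rho>L: "\<rho> x a b \<in> L" if "x \<in> carrier R" "a < n" "b < n" for x a b
    unfolding \<rho>_def using that v by (intro coL) auto
  have \<rho>: "v a \<otimes> x = (\<Oplus>b\<in>{..<n}. \<rho> x a b \<otimes> v b)" if "x \<in> carrier R" "a < n" for x a
    unfolding \<rho>_def using that v by (intro expansion) auto
  have \<rho>I: "\<rho> x a b = k b" if "v a \<otimes> x = (\<Oplus>b\<in>{..<n}. k b \<otimes> v b)" "\<And>b. b < n \<Longrightarrow> k b \<in> L" "b < n"
    for x a b k unfolding \<rho>_def using that by (rule coI)
  have "n > 0"
  proof (rule ccontr)
    assume "\<not> n > 0"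
    then have "carrier R = {\<zero>}" using dim dimension_zero[OF L] by auto
    then show False using ne one_closed by blast
  qed
  have rep: "matrix_representation R (carrier R) ?L n \<rho>"
  proof (intro matrix_representation.intro matrix_representation_axioms.intro)
    show "ring R" by (rule ring_axioms)
    show "ring ?L" by (rule L.ring_axioms)
    show "subring (carrier R) R" by (rule carrier_is_subring)
    show "n > 0" by fact
    show "\<rho> x a b \<in> carrier ?L" if "x \<in> carrier R" "a < n" "b < n" for x a b
      using \<rho>L[OF that] by simp
    show "\<rho> (x \<oplus> y) a b = \<rho> x a b \<oplus>\<^bsub>?L\<^esub> \<rho> y a b"
      if xy: "x \<in> carrier R" "y \<in> carrier R" and ab: "a < n" "b < n" for x y a b
    proof -
      have "v a \<otimes> (x \<oplus> y) = (\<Oplus>b\<in>{..<n}. \<rho> x a b \<otimes> v b) \<oplus> (\<Oplus>b\<in>{..<n}. \<rho> y a b \<otimes> v b)"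
        using xy ab v \<rho> by (simp add: r_distr)
      also have "\<dots> = (\<Oplus>b\<in>{..<n}. \<rho> x a b \<otimes> v b \<oplus> \<rho> y a b \<otimes> v b)"
        using \<rho>L xy ab v Lc by (intro finsum_addf[symmetric]) auto
      also have "\<dots> = (\<Oplus>b\<in>{..<n}. (\<rho> x a b \<oplus> \<rho> y a b) \<otimes> v b)"
        using \<rho>L xy ab v Lc by (intro finsum_cong') (auto simp: l_distr)
      finally have "\<rho> (x \<oplus> y) a b = \<rho> x a b \<oplus> \<rho> y a b"
        using \<rho>L xy ab subringE(7)[OF Lsub] by (intro \<rho>I) auto
      then show ?thesis by simp
    qed
    show "\<rho> (x \<otimes> y) a b = (\<Oplus>\<^bsub>?L\<^esub>c\<in>{..<n}. \<rho> x a c \<otimes>\<^bsub>?L\<^esub> \<rho> y c b)"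
      if xy: "x \<in> carrier R" "y \<in> carrier R" and ab: "a < n" "b < n" for x y a b
    proof -
      have in_L: "\<rho> x a c \<otimes> \<rho> y c b \<in> L" if "c < n" "b < n" for c b
        using \<rho>L xy ab that subringE(6)[OF Lsub] by auto
      have sum_in_L: "(\<Oplus>c\<in>{..<n}. \<rho> x a c \<otimes> \<rho> y c b) \<in> L" if "b < n" for b
      proof -
        have "finsum ?L (\<lambda>c. \<rho> x a c \<otimes> \<rho> y c b) {..<n} \<in> carrier ?L"
          using in_L that by (intro L.finsum_closed) auto
        then show ?thesis using in_L that by (subst (asm) finsum_subring[OF Lsub]) auto
      qed
      have "v a \<otimes> (x \<otimes> y) = (\<Oplus>c\<in>{..<n}. \<rho> x a c \<otimes> v c) \<otimes> y"
        using xy ab v \<rho>[of x a] by (simp add: m_assoc[symmetric])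
      also have "\<dots> = (\<Oplus>c\<in>{..<n}. \<rho> x a c \<otimes> v c \<otimes> y)"
        using xy ab v \<rho>L Lc by (intro finsum_ldistr) auto
      also have "\<dots> = (\<Oplus>c\<in>{..<n}. \<Oplus>b\<in>{..<n}. \<rho> x a c \<otimes> \<rho> y c b \<otimes> v b)"
      proof (intro finsum_cong' refl)
        fix c assume "c \<in> {..<n}"
        then have c: "c < n" by simp
        have "\<rho> x a c \<otimes> v c \<otimes> y = \<rho> x a c \<otimes> (\<Oplus>b\<in>{..<n}. \<rho> y c b \<otimes> v b)"
          using xy ab c v \<rho>L Lc \<rho>[of y c] by (simp add: m_assoc)
        also have "\<dots> = (\<Oplus>b\<in>{..<n}. \<rho> x a c \<otimes> (\<rho> y c b \<otimes> v b))"
          using xy ab c v \<rho>L Lc by (intro finsum_rdistr) auto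
        also have "\<dots> = (\<Oplus>b\<in>{..<n}. \<rho> x a c \<otimes> \<rho> y c b \<otimes> v b)"
          using xy ab c v \<rho>L Lc by (intro finsum_cong') (auto simp: m_assoc)
        finally show "\<rho> x a c \<otimes> v c \<otimes> y = (\<Oplus>b\<in>{..<n}. \<rho> x a c \<otimes> \<rho> y c b \<otimes> v b)" .
      qed (use xy ab v \<rho>L Lc in \<open>auto intro!: finsum_closed\<close>)
      also have "\<dots> = (\<Oplus>b\<in>{..<n}. \<Oplus>c\<in>{..<n}. \<rho> x a c \<otimes> \<rho> y c b \<otimes> v b)"
        using xy ab v \<rho>L Lc by (intro finsum_swap) auto
      also have "\<dots> = (\<Oplus>b\<in>{..<n}. (\<Oplus>c\<in>{..<n}. \<rho> x a c \<otimes> \<rho> y c b) \<otimes> v b)"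
        using xy ab v \<rho>L Lc by (intro finsum_cong' refl finsum_ldistr[symmetric]) auto
      finally have "\<rho> (x \<otimes> y) a b = (\<Oplus>c\<in>{..<n}. \<rho> x a c \<otimes> \<rho> y c b)"
        using sum_in_L ab by (intro \<rho>I) auto
      also have "\<dots> = (\<Oplus>\<^bsub>?L\<^esub>c\<in>{..<n}. \<rho> x a c \<otimes> \<rho> y c b)"
        using in_L ab by (intro finsum_subring[OF Lsub, symmetric]) auto
      finally show ?thesis by simp
    qed
    show "\<rho> \<one> a b = (if a = b then \<one>\<^bsub>?L\<^esub> else \<zero>\<^bsub>?L\<^esub>)" if "a < n" "b < n" for a b
    proof -
      have "(\<Oplus>b\<in>{..<n}. (if a = b then \<one> else \<zero>) \<otimes> v b) = (\<Oplus>b\<in>{..<n}. if a = b then v b else \<zero>)"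
        using v by (intro finsum_cong') auto
      also have "\<dots> = v a \<otimes> \<one>"
        using that v by (subst finsum_singleton) auto
      finally have "v a \<otimes> \<one> = (\<Oplus>b\<in>{..<n}. (if a = b then \<one> else \<zero>) \<otimes> v b)" by simp
      then have "\<rho> \<one> a b = (if a = b then \<one> else \<zero>)"
        using that subringE(2,3)[OF Lsub] by (intro \<rho>I) auto
      then show ?thesis by simp
    qed
  qed
  have faithful: "\<exists>a<n. \<exists>b<n. \<rho> x a b \<noteq> \<zero>" if x: "x \<in> carrier R" "x \<noteq> \<zero>" for x
  proof (rule ccontr)
    assume none: "\<not> ?thesis"
    have vx: "v a \<otimes> x = \<zero>" if "a < n" for a
    proof -
      have "v a \<otimes> x = (\<Oplus>b\<in>{..<n}. \<zero>)"
        unfolding \<rho>[OF x(1) that] using none that v by (intro finsum_cong') auto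
      then show ?thesis by simp
    qed
    have "x = (\<Oplus>b\<in>{..<n}. co \<one> ! b \<otimes> v b) \<otimes> x"
      using expansion[of \<one>] x by simp
    also have "\<dots> = (\<Oplus>b\<in>{..<n}. co \<one> ! b \<otimes> v b \<otimes> x)"
      using coL v Lc x by (intro finsum_ldistr) auto
    also have "\<dots> = (\<Oplus>b\<in>{..<n}. \<zero>)"
      using coL v Lc x vx by (intro finsum_cong') (auto simp: m_assoc)
    finally show False using x by simp
  qed
  show ?thesis
  proof (rule stably_finite_if_residually_represented[OF ring_axioms \<Gamma>])
    fix C c assume "C \<subseteq> carrier R" "c \<in> C" "c \<noteq> \<zero>"
    then show "\<exists>D n \<rho> (S :: ('a, 'b) ring_scheme). matrix_representation R D S n \<rho> \<and> stably_finite (group_ring S \<Gamma>) \<and>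
        C \<subseteq> D \<and> (\<exists>a<n. \<exists>b<n. \<rho> c a b \<noteq> \<zero>\<^bsub>S\<^esub>)"
      using rep fin faithful[of c]
      by (intro exI[of _ "carrier R"] exI[of _ n] exI[of _ \<rho>] exI[of _ ?L]) auto
  qed
qed

end

section \<open>Quotients of polynomial rings and localisations\<close>

text \<open>
The quotient \<open>L[X]/(f)\<close> has dimension \<open>degree f\<close> over the image of \<open>L\<close>, which is isomorphic to
\<open>L\<close>. Reducible \<open>f\<close> occur below, in the treatment of transcendental elements.
\<close>

lemma (in domain) rupture_stably_finite:
  assumes L: "subfield L R" and f: "f \<in> carrier (L[X])" "degree f > 0"
    and \<Gamma>: "group \<Gamma>" and fin: "stably_finite (group_ring (R\<lparr>carrier := L\<rparr>) \<Gamma>)"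
  shows "stably_finite (group_ring (Rupt L f) \<Gamma>)"
proof -
  note Lsub = subfieldE(1)[OF L]
  let ?E = "Rupt L f" and ?h = "rupture_surj L f \<circ> poly_of_const"
  interpret Hom: ring_hom_ring "L[X]" ?E "rupture_surj L f"
    using rupture_surj_hom(2)[OF Lsub f(1)] .
  have ne: "\<one>\<^bsub>?E\<^esub> \<noteq> \<zero>\<^bsub>?E\<^esub>"
    using L f by (rule rupture_one_not_zero)
  interpret L: field "R\<lparr>carrier := L\<rparr>" using L by (rule subfield_iff(2))
  interpret h: ring_hom_ring "R\<lparr>carrier := L\<rparr>" ?E ?h
    using L.ring_axioms Hom.S.ring_axioms rupture_surj_norm_is_hom[OF Lsub f(1)]
    by (rule ring_hom_ringI2)
  have Lfield: "subfield L (R\<lparr>carrier := L\<rparr>)"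
    using L.carrier_is_subfield by simp
  note inj = h.img_is_subfield(1)[OF Lfield ne]
  have image: "subfield (?h ` L) ?E" using Lfield ne by (rule h.img_is_subfield(2))
  have "ring_hom_ring (?E\<lparr>carrier := ?h ` L\<rparr>) (R\<lparr>carrier := L\<rparr>) (inv_into L ?h)"
    using inj subfieldE(1)[OF Lfield] by (rule h.inv_ring_hom)
  then interpret inv: ring_hom_ring "?E\<lparr>carrier := ?h ` L\<rparr>" "R\<lparr>carrier := L\<rparr>" "inv_into L ?h" .
  have scalars: "stably_finite (group_ring (?E\<lparr>carrier := ?h ` L\<rparr>) \<Gamma>)"
  proof (rule stably_finite_if_embeds[OF inv.R.ring_axioms L.ring_axioms \<Gamma> inv.homh _ fin])
    fix x assume x: "x \<in> carrier (?E\<lparr>carrier := ?h ` L\<rparr>)"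
      and zero: "inv_into L ?h x = \<zero>\<^bsub>R\<lparr>carrier := L\<rparr>\<^esub>"
    have "x = ?h (inv_into L ?h x)" using f_inv_into_f[of x ?h L] x by simp
    also have "\<dots> = \<zero>\<^bsub>?E\<^esub>" unfolding zero by (rule h.hom_zero)
    finally show "x = \<zero>\<^bsub>?E\<lparr>carrier := ?h ` L\<rparr>\<^esub>" by simp
  qed
  have "ring.dimension ?E (degree f) (?h ` L) (carrier ?E)"
    using rupture_dimension[OF L f] by (simp add: image_comp)
  then show ?thesis
    by (rule Hom.S.stably_finite_if_finite_dimension[OF image _ ne \<Gamma> scalars])
qed

text \<open>
For a subring \<open>D\<close> of a field and a nonzero \<open>a\<close> in \<open>D\<close> this is \<open>D[1/a]\<close>, described without
division.
\<close>

definition (in monoid) localisation :: "'a set \<Rightarrow> 'a \<Rightarrow> 'a set" where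
  "localisation D a = {z \<in> carrier G. \<exists>k::nat. a [^] k \<otimes> z \<in> D}"

lemma (in monoid) localisationI:
  fixes k :: nat
  shows "\<lbrakk>z \<in> carrier G; a [^] k \<otimes> z \<in> D\<rbrakk> \<Longrightarrow> z \<in> localisation D a"
  by (auto simp: localisation_def)

lemma (in cring) localisation_subring:
  assumes D: "subring D R" and a: "a \<in> D"
  shows "subring (localisation D a) R"
proof (rule subringI)
  note Dc = subsetD[OF subringE(1)[OF D]]
  have pow: "a [^] k \<in> D" for k :: nat
    using a by (induction k) (simp_all add: subringE(3,6)[OF D])
  have ac: "a \<in> carrier R" using a Dc by blast
  show "localisation D a \<subseteq> carrier R" by (auto simp: localisation_def)
  show "\<one> \<in> localisation D a"
    using subringE(3)[OF D] by (intro localisationI[of _ _ 0]) simp_all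
  show "\<ominus> z \<in> localisation D a" if "z \<in> localisation D a" for z
    using that ac subringE(5)[OF D] by (auto simp: localisation_def r_minus)
  fix z w assume "z \<in> localisation D a" "w \<in> localisation D a"
  then obtain k m :: nat where z: "z \<in> carrier R" "a [^] k \<otimes> z \<in> D" and w: "w \<in> carrier R" "a [^] m \<otimes> w \<in> D"
    by (auto simp: localisation_def)
  have "a [^] (k + m) \<otimes> (z \<otimes> w) = (a [^] k \<otimes> z) \<otimes> (a [^] m \<otimes> w)"
    using z w ac by (simp add: nat_pow_mult[symmetric] m_ac)
  also have "\<dots> \<in> D" by (rule subringE(6)[OF D z(2) w(2)])
  finally show "z \<otimes> w \<in> localisation D a" by (rule localisationI[rotated]) (simp add: z w)
  have "a [^] (k + m) \<otimes> (z \<oplus> w) = a [^] m \<otimes> (a [^] k \<otimes> z) \<oplus> a [^] k \<otimes> (a [^] m \<otimes> w)"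
    using z w ac by (simp add: nat_pow_mult[symmetric] m_ac r_distr)
  also have "\<dots> \<in> D" using z w pow by (blast intro: subringE(6,7)[OF D])
  finally show "z \<oplus> w \<in> localisation D a" by (rule localisationI[rotated]) (simp add: z w)
qed

text \<open>
The universal property of \<open>D[1/a]\<close>: an element \<open>z\<close> with \<open>a^k z\<close> in \<open>D\<close> is sent to
\<open>\<psi> (a^k z) y^k\<close>. The value does not depend on \<open>k\<close>, because raising \<open>k\<close> by \<open>m\<close>
multiplies it by \<open>\<psi> (a)^m y^m = 1\<close>.
\<close>

lemma (in cring) extend_hom_to_localisation:
  fixes S :: "('c, 'd) ring_scheme"
  assumes D: "subring D R" and a: "a \<in> D" and S: "cring S"
    and hom: "\<psi> \<in> ring_hom (R\<lparr>carrier := D\<rparr>) S"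
    and y: "y \<in> carrier S" "\<psi> a \<otimes>\<^bsub>S\<^esub> y = \<one>\<^bsub>S\<^esub>"
  obtains \<phi> where "\<phi> \<in> ring_hom (R\<lparr>carrier := localisation D a\<rparr>) S" "\<And>z. z \<in> D \<Longrightarrow> \<phi> z = \<psi> z"
proof -
  interpret S: cring S by fact
  note Dc = subsetD[OF subringE(1)[OF D]]
  have ac: "a \<in> carrier R" using a Dc by blast
  have pow: "a [^] k \<in> D" for k :: nat
    using a by (induction k) (simp_all add: subringE(3,6)[OF D])
  have \<psi>: "\<And>u. u \<in> D \<Longrightarrow> \<psi> u \<in> carrier S"
    "\<And>u v. \<lbrakk>u \<in> D; v \<in> D\<rbrakk> \<Longrightarrow> \<psi> (u \<otimes> v) = \<psi> u \<otimes>\<^bsub>S\<^esub> \<psi> v"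
    "\<And>u v. \<lbrakk>u \<in> D; v \<in> D\<rbrakk> \<Longrightarrow> \<psi> (u \<oplus> v) = \<psi> u \<oplus>\<^bsub>S\<^esub> \<psi> v" "\<psi> \<one> = \<one>\<^bsub>S\<^esub>"
    using ring_hom_memE[OF hom] by simp_all
  define frac where "frac k z = \<psi> (a [^] k \<otimes> z) \<otimes>\<^bsub>S\<^esub> y [^]\<^bsub>S\<^esub> k" for k :: nat and z
  have ay: "\<psi> (a [^] m) \<otimes>\<^bsub>S\<^esub> y [^]\<^bsub>S\<^esub> m = \<one>\<^bsub>S\<^esub>" for m :: nat
  proof (induction m)
    case 0
    then show ?case using \<psi>(4) by simp
  next
    case (Suc m)
    have "\<psi> (a [^] Suc m) \<otimes>\<^bsub>S\<^esub> y [^]\<^bsub>S\<^esub> Suc m = (\<psi> (a [^] m) \<otimes>\<^bsub>S\<^esub> y [^]\<^bsub>S\<^esub> m) \<otimes>\<^bsub>S\<^esub> (\<psi> a \<otimes>\<^bsub>S\<^esub> y)"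
      using pow a \<psi>(1) y(1) by (simp add: \<psi>(2) S.m_ac)
    then show ?case using Suc y by simp
  qed
  have raise: "frac (m + k) z = frac k z" if "z \<in> carrier R" "a [^] k \<otimes> z \<in> D" for k m :: nat and z
  proof -
    have "a [^] (m + k) \<otimes> z = a [^] m \<otimes> (a [^] k \<otimes> z)"
      using that ac by (simp add: nat_pow_mult[symmetric] m_assoc)
    then have "frac (m + k) z = (\<psi> (a [^] m) \<otimes>\<^bsub>S\<^esub> \<psi> (a [^] k \<otimes> z)) \<otimes>\<^bsub>S\<^esub> (y [^]\<^bsub>S\<^esub> m \<otimes>\<^bsub>S\<^esub> y [^]\<^bsub>S\<^esub> k)"
      unfolding frac_def using pow that y by (simp add: \<psi>(2) S.nat_pow_mult)
    also have "\<dots> = (\<psi> (a [^] m) \<otimes>\<^bsub>S\<^esub> y [^]\<^bsub>S\<^esub> m) \<otimes>\<^bsub>S\<^esub> frac k z"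
      unfolding frac_def using pow that y \<psi>(1) by (simp add: S.m_ac)
    finally show ?thesis using ay that \<psi>(1) y by (simp add: frac_def)
  qed
  define \<phi> where "\<phi> z = frac (SOME k. a [^] k \<otimes> z \<in> D) z" for z
  have \<phi>: "\<phi> z = frac k z" if "z \<in> carrier R" "a [^] k \<otimes> z \<in> D" for k z
  proof -
    let ?m = "SOME k. a [^] (k::nat) \<otimes> z \<in> D"
    have "a [^] ?m \<otimes> z \<in> D" using that(2) by (rule someI)
    then have "frac ?m z = frac (k + ?m) z" using that(1) raise by simp
    also have "\<dots> = frac (?m + k) z" by (simp only: add.commute)
    also have "\<dots> = frac k z" using that raise by simp
    finally show ?thesis by (simp add: \<phi>_def)
  qed
  show thesis
  proof
    show on_D: "\<phi> z = \<psi> z" if "z \<in> D" for z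
      using \<phi>[of z 0] that Dc \<psi>(1) by (simp add: frac_def)
    show "\<phi> \<in> ring_hom (R\<lparr>carrier := localisation D a\<rparr>) S"
    proof (rule ring_hom_memI)
      show "\<phi> \<one>\<^bsub>R\<lparr>carrier := localisation D a\<rparr>\<^esub> = \<one>\<^bsub>S\<^esub>"
        using on_D[of \<one>] subringE(3)[OF D] \<psi>(4) by simp
      fix z assume "z \<in> carrier (R\<lparr>carrier := localisation D a\<rparr>)"
      then obtain k :: nat where z: "z \<in> carrier R" "a [^] k \<otimes> z \<in> D"
        by (auto simp: localisation_def)
      show "\<phi> z \<in> carrier S" using \<phi>[OF z] \<psi>(1)[OF z(2)] y by (simp add: frac_def)
      fix w assume "w \<in> carrier (R\<lparr>carrier := localisation D a\<rparr>)"
      then obtain m :: nat where w: "w \<in> carrier R" "a [^] m \<otimes> w \<in> D"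
        by (auto simp: localisation_def)
      have mult: "a [^] (k + m) \<otimes> (z \<otimes> w) = (a [^] k \<otimes> z) \<otimes> (a [^] m \<otimes> w)"
        using z w ac by (simp add: nat_pow_mult[symmetric] m_ac)
      then have "a [^] (k + m) \<otimes> (z \<otimes> w) \<in> D" using z w subringE(6)[OF D] by simp
      then have "\<phi> (z \<otimes> w) = frac (k + m) (z \<otimes> w)" using z w by (intro \<phi>) auto
      also have "\<dots> = (\<psi> (a [^] k \<otimes> z) \<otimes>\<^bsub>S\<^esub> \<psi> (a [^] m \<otimes> w)) \<otimes>\<^bsub>S\<^esub> (y [^]\<^bsub>S\<^esub> k \<otimes>\<^bsub>S\<^esub> y [^]\<^bsub>S\<^esub> m)"
        unfolding frac_def mult using z w y by (simp add: \<psi>(2) S.nat_pow_mult)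
      also have "\<dots> = \<phi> z \<otimes>\<^bsub>S\<^esub> \<phi> w"
        using \<phi>[OF z] \<phi>[OF w] \<psi>(1)[OF z(2)] \<psi>(1)[OF w(2)] y by (simp add: frac_def S.m_ac)
      finally show "\<phi> (z \<otimes>\<^bsub>R\<lparr>carrier := localisation D a\<rparr>\<^esub> w) = \<phi> z \<otimes>\<^bsub>S\<^esub> \<phi> w" by simp
      have z': "a [^] (m + k) \<otimes> z \<in> D" and w': "a [^] (k + m) \<otimes> w \<in> D"
        using z w ac pow subringE(6)[OF D] by (simp_all add: nat_pow_mult[symmetric] m_assoc)
      have add: "a [^] (k + m) \<otimes> (z \<oplus> w) = a [^] (m + k) \<otimes> z \<oplus> a [^] (k + m) \<otimes> w"
        using z w ac by (simp add: r_distr add.commute)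
      then have "a [^] (k + m) \<otimes> (z \<oplus> w) \<in> D" using z' w' subringE(7)[OF D] by simp
      then have "\<phi> (z \<oplus> w) = frac (k + m) (z \<oplus> w)" using z w by (intro \<phi>) auto
      also have "\<dots> = frac (m + k) z \<oplus>\<^bsub>S\<^esub> frac (k + m) w"
        unfolding frac_def add using z' w' y \<psi>(1) by (simp add: \<psi>(3) S.l_distr add.commute)
      also have "\<dots> = \<phi> z \<oplus>\<^bsub>S\<^esub> \<phi> w"
        using \<phi>[OF z(1) z'] \<phi>[OF w(1) w'] by simp
      finally show "\<phi> (z \<oplus>\<^bsub>R\<lparr>carrier := localisation D a\<rparr>\<^esub> w) = \<phi> z \<oplus>\<^bsub>S\<^esub> \<phi> w" by simp
    qed
  qed
qed

section \<open>Simple field extensions\<close>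

context field
begin

text \<open>
The fraction field of \<open>D\<close> inside the ambient field.
\<close>

definition fractions :: "'a set \<Rightarrow> 'a set" where
  "fractions D = {z \<in> carrier R. \<exists>a\<in>D - {\<zero>}. a \<otimes> z \<in> D}"

lemma fractionsI: "\<lbrakk>z \<in> carrier R; a \<in> D; a \<noteq> \<zero>; a \<otimes> z \<in> D\<rbrakk> \<Longrightarrow> z \<in> fractions D"
  by (auto simp: fractions_def)

lemma fractions_subfield:
  assumes D: "subring D R"
  shows "subfield (fractions D) R"
proof (rule subfieldI')
  note Dc = subsetD[OF subringE(1)[OF D]]
  show "subring (fractions D) R"
  proof (rule subringI)
    show "fractions D \<subseteq> carrier R" by (auto simp: fractions_def)
    show "\<one> \<in> fractions D" using subringE(3)[OF D] by (intro fractionsI[of _ \<one>]) simp_all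
    show "\<ominus> z \<in> fractions D" if "z \<in> fractions D" for z
    proof -
      obtain a where a: "z \<in> carrier R" "a \<in> D" "a \<noteq> \<zero>" "a \<otimes> z \<in> D"
        using \<open>z \<in> fractions D\<close> by (auto simp: fractions_def)
      then show ?thesis
        using Dc subringE(5)[OF D a(4)] by (intro fractionsI[of _ a]) (simp_all add: r_minus)
    qed
    fix z w assume "z \<in> fractions D" "w \<in> fractions D"
    then obtain a b where z: "z \<in> carrier R" "a \<in> D" "a \<noteq> \<zero>" "a \<otimes> z \<in> D"
      and w: "w \<in> carrier R" "b \<in> D" "b \<noteq> \<zero>" "b \<otimes> w \<in> D"
      by (auto simp: fractions_def)
    have ab: "a \<otimes> b \<in> D - {\<zero>}"
      using z w Dc subringE(6)[OF D] by (auto simp: integral_iff)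
    have "a \<otimes> b \<otimes> (z \<otimes> w) = (a \<otimes> z) \<otimes> (b \<otimes> w)"
      using z w Dc by (simp add: m_ac)
    also have "\<dots> \<in> D" by (rule subringE(6)[OF D z(4) w(4)])
    finally show "z \<otimes> w \<in> fractions D" using ab z w by (intro fractionsI[of _ "a \<otimes> b"]) simp_all
    have "a \<otimes> b \<otimes> (z \<oplus> w) = b \<otimes> (a \<otimes> z) \<oplus> a \<otimes> (b \<otimes> w)"
      using z w Dc by (simp add: r_distr m_ac)
    also have "\<dots> \<in> D" using z w by (blast intro: subringE(6,7)[OF D])
    finally show "z \<oplus> w \<in> fractions D" using ab z w by (intro fractionsI[of _ "a \<otimes> b"]) simp_all
  qed
  fix z assume "z \<in> fractions D - {\<zero>}"
  then obtain a where z: "z \<in> carrier R" "z \<noteq> \<zero>" "a \<in> D" "a \<noteq> \<zero>" "a \<otimes> z \<in> D"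
    by (auto simp: fractions_def)
  have zU: "z \<in> Units R" using z by (simp add: field_Units)
  have "(a \<otimes> z) \<otimes> inv z = a" using zU z Dc by (simp add: m_assoc)
  moreover have "a \<otimes> z \<noteq> \<zero>" using z Dc by (simp add: integral_iff)
  ultimately show "inv z \<in> fractions D"
    using z zU by (intro fractionsI[of _ "a \<otimes> z"]) simp_all
qed

lemma common_denominator:
  assumes D: "subring D R" and "finite C" "C \<subseteq> fractions D"
  shows "\<exists>a\<in>D - {\<zero>}. \<forall>z\<in>C. a \<otimes> z \<in> D"
  using assms(2,3)
proof (induction C rule: finite_induct)
  case empty
  then show ?case using subringE(3)[OF D] by auto
next
  note Dc = subsetD[OF subringE(1)[OF D]]
  case (insert z C)
  then obtain a where a: "a \<in> D" "a \<noteq> \<zero>" "\<And>w. w \<in> C \<Longrightarrow> a \<otimes> w \<in> D" by auto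
  obtain b where b: "b \<in> D" "b \<noteq> \<zero>" "b \<otimes> z \<in> D" using insert by (auto simp: fractions_def)
  have C: "w \<in> carrier R" if "w \<in> insert z C" for w using that insert by (auto simp: fractions_def)
  have "a \<otimes> b \<in> D - {\<zero>}" using a b Dc subringE(6)[OF D] by (auto simp: integral_iff)
  moreover have "a \<otimes> b \<otimes> w \<in> D" if "w \<in> insert z C" for w
  proof (cases "w = z")
    case True
    have "a \<otimes> b \<otimes> z = a \<otimes> (b \<otimes> z)" using a b C Dc by (simp add: m_assoc)
    then show ?thesis using True a b subringE(6)[OF D] by simp
  next
    case False
    have "a \<otimes> b \<otimes> w = b \<otimes> (a \<otimes> w)" using a b C that Dc by (simp add: m_ac)
    then show ?thesis using False that a b subringE(6)[OF D] by simp
  qed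
  ultimately show ?case by blast
qed

lemma subring_of_subring:
  assumes "subring T R" "subring E R" "T \<subseteq> E"
  shows "subring T (R\<lparr>carrier := E\<rparr>)"
  using ring.ring_incl_imp_subring[OF subring_is_ring[OF assms(2)], of T]
    subring_is_ring[OF assms(1)] assms(3) by simp

end

lemma (in domain) degree_times_var_pow_minus_one:
  assumes L: "subring L R" and p: "p \<in> carrier (L[X])" "p \<noteq> []" and N: "N > 0"
  shows "degree (p \<otimes>\<^bsub>L[X]\<^esub> X [^]\<^bsub>L[X]\<^esub> (N::nat) \<ominus>\<^bsub>L[X]\<^esub> \<one>\<^bsub>L[X]\<^esub>) = degree p + N"
proof -
  interpret UP: domain "L[X]" using L by (rule univ_poly_is_domain)
  let ?q = "p \<otimes>\<^bsub>L[X]\<^esub> X [^]\<^bsub>L[X]\<^esub> N"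
  have XN: "X [^]\<^bsub>L[X]\<^esub> N \<in> carrier (L[X])" using L by (rule var_pow_closed)
  have "length (X [^]\<^bsub>L[X]\<^esub> N) = Suc N"
    by (simp add: unitary_monom_eq_var_pow[OF L, symmetric] monom_def)
  then have q: "degree ?q = degree p + N"
    using poly_mult_degree_eq[OF L, of p "X [^]\<^bsub>L[X]\<^esub> N"] p XN
    by (auto simp: univ_poly_mult univ_poly_carrier)
  have one: "degree (\<ominus>\<^bsub>L[X]\<^esub> \<one>\<^bsub>L[X]\<^esub>) = 0"
    using univ_poly_a_inv_degree[OF L UP.one_closed] by (simp add: univ_poly_one)
  have "degree (poly_add ?q (\<ominus>\<^bsub>L[X]\<^esub> \<one>\<^bsub>L[X]\<^esub>)) = max (degree ?q) (degree (\<ominus>\<^bsub>L[X]\<^esub> \<one>\<^bsub>L[X]\<^esub>))"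
    using p XN q one N by (intro poly_add_degree_eq[OF L]) (auto simp: univ_poly_carrier)
  then show ?thesis
    using q one by (simp add: a_minus_def univ_poly_add)
qed

lemma (in domain) rupture_is_cring:
  assumes L: "subring L R" and f: "f \<in> carrier (L[X])"
  shows "cring (Rupt L f)"
proof -
  interpret UP: domain "L[X]" using L by (rule univ_poly_is_domain)
  show ?thesis
    unfolding rupture_def using UP.cgenideal_ideal[OF f] UP.is_cring
    by (rule ideal.quotient_is_cring)
qed

lemma (in domain) rupture_surj_generator:
  assumes L: "subring L R" and f: "f \<in> carrier (L[X])"
  shows "rupture_surj L f f = \<zero>\<^bsub>Rupt L f\<^esub>"
proof -
  interpret UP: domain "L[X]" using L by (rule univ_poly_is_domain)
  show ?thesis
    using UP.a_rcos_zero[OF UP.cgenideal_ideal[OF f] UP.cgenideal_self[OF f]]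
    unfolding rupture_def FactRing_def by simp
qed

text \<open>
A polynomial of length at most \<open>degree f\<close> is its own remainder modulo \<open>f\<close>, and distinct
remainders have distinct classes.
\<close>

lemma (in domain) rupture_surj_eq_zero_imp:
  assumes L: "subfield L R" and f: "f \<in> carrier (L[X])" "f \<noteq> []"
    and q: "q \<in> carrier (L[X])" "length q \<le> degree f"
    and zero: "rupture_surj L f q = \<zero>\<^bsub>Rupt L f\<^esub>"
  shows "q = []"
proof -
  note Lsub = subfieldE(1)[OF L]
  interpret Hom: ring_hom_ring "L[X]" "Rupt L f" "rupture_surj L f"
    using rupture_surj_hom(2)[OF Lsub f(1)] .
  have "rupture_surj L f [] = \<zero>\<^bsub>Rupt L f\<^esub>"
    using Hom.hom_zero by (simp add: univ_poly_zero)
  moreover have "{q, []} \<subseteq> (\<lambda>q. q pmod f) ` carrier (L[X])"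
    using q unfolding pmod_image_characterization[OF L f] by auto
  ultimately show ?thesis
    using rupture_surj_inj_on[OF L f(1)] zero by (auto dest: inj_onD)
qed

text \<open>
Here \<open>D\<close> is \<open>L[x]\<close>, which is isomorphic to \<open>L[X]\<close> through \<open>h\<close>. A finite set \<open>C\<close> in \<open>L(x)\<close> with a
common denominator \<open>a\<close> lies in \<open>D[1/a]\<close>, and \<open>D[1/a]\<close> maps to \<open>L[X]/(f)\<close> for
\<open>f = h a X^N - 1\<close>. If \<open>c\<close> were sent to zero, so would be the polynomial \<open>h (a c)\<close>, which is
impossible when \<open>N\<close> is large.
\<close>

theorem (in field) stably_finite_transcendental_extension:
  assumes L: "subfield L R" and x: "x \<in> carrier R" "(transcendental over L) x"
    and \<Gamma>: "group \<Gamma>" and fin: "stably_finite (group_ring (R\<lparr>carrier := L\<rparr>) \<Gamma>)"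
  shows "stably_finite (group_ring (R\<lparr>carrier := fractions (simple_extension L x)\<rparr>) \<Gamma>)"
proof -
  note Lsub = subfieldE(1)[OF L]
  define D where "D = simple_extension L x"
  have D: "subring D R" unfolding D_def using Lsub x(1) by (rule simple_extension_is_subring)
  note Dc = subsetD[OF subringE(1)[OF D]]
  have E: "subring (fractions D) R" using fractions_subfield[OF D] by (rule subfieldE(1))
  interpret UP: domain "L[X]" using Lsub by (rule univ_poly_is_domain)
  obtain h where h: "h \<in> ring_iso (R\<lparr>carrier := D\<rparr>) (L[X])"
    using ring_iso_sym[OF UP.ring_axioms simple_extension_of_transcendental[OF Lsub x]]
    unfolding D_def is_ring_iso_def by blast
  have h_hom: "h \<in> ring_hom (R\<lparr>carrier := D\<rparr>) (L[X])" and h_inj: "inj_on h D"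
    using h by (auto simp: ring_iso_def bij_betw_def)
  interpret h: ring_hom_ring "R\<lparr>carrier := D\<rparr>" "L[X]" h
    using subring_is_ring[OF D] UP.ring_axioms h_hom by (rule ring_hom_ringI2)
  have h_zero: "h \<zero> = []" using h.hom_zero by (simp add: univ_poly_zero)
  have h_closed: "h u \<in> carrier (L[X])" if "u \<in> D" for u using h.hom_closed[of u] that by simp
  have h_nonzero: "h u \<noteq> []" if "u \<in> D" "u \<noteq> \<zero>" for u
    using that h_inj h_zero subringE(2)[OF D] by (metis inj_onD)
  show ?thesis
    unfolding D_def[symmetric]
  proof (rule stably_finite_if_residual_homs[OF subring_is_ring[OF E] \<Gamma>], simp_all)
    fix C c assume C: "finite C" "C \<subseteq> fractions D" and c: "c \<in> C" "c \<noteq> \<zero>"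
    obtain a where a: "a \<in> D" "a \<noteq> \<zero>" "\<And>z. z \<in> C \<Longrightarrow> a \<otimes> z \<in> D"
      using common_denominator[OF D C] by auto
    have Cc: "z \<in> carrier R" if "z \<in> C" for z using that C by (auto simp: fractions_def)
    define d where "d = a \<otimes> c"
    have d: "d \<in> D" "d \<noteq> \<zero>" using a c Cc Dc by (auto simp: d_def integral_iff)
    \<comment> \<open>the length of a polynomial is one more than its degree, so \<open>N\<close> exceeds the degree of \<open>h d\<close>\<close>
    define N where "N = length (h d)"
    have N: "N > 0" using h_nonzero[OF d] by (simp add: N_def)
    let ?XN = "X [^]\<^bsub>L[X]\<^esub> N"
    define f where "f = h a \<otimes>\<^bsub>L[X]\<^esub> ?XN \<ominus>\<^bsub>L[X]\<^esub> \<one>\<^bsub>L[X]\<^esub>"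
    have XN: "?XN \<in> carrier (L[X])" using Lsub by (rule var_pow_closed)
    have f: "f \<in> carrier (L[X])" 
      unfolding f_def by (intro UP.minus_closed UP.m_closed UP.one_closed XN h_closed a(1))
    have deg: "degree f = degree (h a) + N"
      unfolding f_def using Lsub h_closed[OF a(1)] h_nonzero[OF a(1,2)] N
      by (rule degree_times_var_pow_minus_one)
    let ?S = "Rupt L f" and ?s = "rupture_surj L f"
    interpret s: ring_hom_ring "L[X]" ?S ?s
      using rupture_surj_hom(2)[OF Lsub f] .
    have f0: "?s f = \<zero>\<^bsub>?S\<^esub>" using Lsub f by (rule rupture_surj_generator)
    have S: "cring ?S" using Lsub f by (rule rupture_is_cring)
    have "h a \<otimes>\<^bsub>L[X]\<^esub> ?XN = f \<oplus>\<^bsub>L[X]\<^esub> \<one>\<^bsub>L[X]\<^esub>"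
      unfolding f_def using XN h_closed[OF a(1)] by (simp add: UP.minus_eq UP.a_assoc UP.l_neg)
    then have "?s (h a \<otimes>\<^bsub>L[X]\<^esub> ?XN) = ?s f \<oplus>\<^bsub>?S\<^esub> \<one>\<^bsub>?S\<^esub>"
      using f by simp
    then have inv: "(?s \<circ> h) a \<otimes>\<^bsub>?S\<^esub> ?s ?XN = \<one>\<^bsub>?S\<^esub>"
      using f0 XN h_closed[OF a(1)] by simp
    obtain \<phi> where \<phi>: "\<phi> \<in> ring_hom (R\<lparr>carrier := localisation D a\<rparr>) ?S"
      and on_D: "\<And>z. z \<in> D \<Longrightarrow> \<phi> z = (?s \<circ> h) z"
      using extend_hom_to_localisation[OF D a(1) S ring_hom_trans[OF h_hom s.homh] _ inv] XN by auto
    have T: "subring (localisation D a) R" using D a(1) by (rule localisation_subring)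
    have powD: "a [^] k \<in> D - {\<zero>}" for k :: nat
    proof (induction k)
      case 0
      then show ?case using subringE(3)[OF D] by simp
    next
      case (Suc k)
      then show ?case using a(1,2) Dc subringE(6)[OF D] by (simp add: integral_iff)
    qed
    have TE: "localisation D a \<subseteq> fractions D"
      using powD by (auto simp: localisation_def fractions_def)
    have CT: "C \<subseteq> localisation D a"
      using a Cc Dc by (auto intro!: localisationI[of _ _ 1])
    \<comment> \<open>\<open>a c\<close> lies in \<open>D\<close>, where the map is reduction modulo \<open>f\<close>; this decides whether \<open>c\<close> is killed\<close>
    have aT: "a \<in> localisation D a" using a Dc by (intro localisationI[of _ _ 0]) auto
    have "\<phi> c \<noteq> \<zero>\<^bsub>?S\<^esub>"
    proof
      assume "\<phi> c = \<zero>\<^bsub>?S\<^esub>"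
      moreover have "\<phi> d = \<phi> a \<otimes>\<^bsub>?S\<^esub> \<phi> c"
        using ring_hom_mult[OF \<phi>, of a c] aT CT c by (auto simp: d_def)
      moreover have "\<phi> a \<in> carrier ?S" using ring_hom_closed[OF \<phi>, of a] aT by simp
      ultimately have "?s (h d) = \<zero>\<^bsub>?S\<^esub>" using on_D[OF d(1)] by simp
      moreover have "f \<noteq> []" using deg N by auto
      ultimately have "h d = []"
        using deg by (intro rupture_surj_eq_zero_imp[OF L f _ h_closed[OF d(1)]]) (auto simp: N_def)
      then show False using h_nonzero[OF d] by simp
    qed
    moreover have "stably_finite (group_ring ?S \<Gamma>)"
      using deg N by (intro rupture_stably_finite[OF L f _ \<Gamma> fin]) simp
    ultimately show "\<exists>T. subring T (R\<lparr>carrier := fractions D\<rparr>) \<and> (\<exists>\<phi> (S :: 'a list set ring).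
        ring S \<and> \<phi> \<in> ring_hom (R\<lparr>carrier := T\<rparr>) S \<and>
        stably_finite (group_ring S \<Gamma>) \<and> C \<subseteq> T \<and> \<phi> c \<noteq> \<zero>\<^bsub>S\<^esub>)"
      using subring_of_subring[OF T E TE] s.S.ring_axioms \<phi> CT by blast
  qed
qed

text \<open>
A transcendental \<open>x\<close> calls for the fraction field of \<open>L[x]\<close>; for an algebraic one \<open>L[x]\<close> is
already a field, namely \<open>L[X]\<close> modulo the minimal polynomial.
\<close>

lemma (in field) stably_finite_adjoin:
  assumes L: "subfield L R" and x: "x \<in> carrier R"
    and \<Gamma>: "group \<Gamma>" and fin: "stably_finite (group_ring (R\<lparr>carrier := L\<rparr>) \<Gamma>)"
  shows "\<exists>E. subfield E R \<and> insert x L \<subseteq> E \<and> stably_finite (group_ring (R\<lparr>carrier := E\<rparr>) \<Gamma>)"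
proof -
  note Lsub = subfieldE(1)[OF L]
  let ?D = "simple_extension L x"
  have D: "subring ?D R" using Lsub x by (rule simple_extension_is_subring)
  have D_incl: "insert x L \<subseteq> ?D"
    using simple_extension_mem[OF Lsub x] simple_extension_incl[OF subringE(1)[OF Lsub] x] by simp
  show ?thesis
  proof (cases "(transcendental over L) x")
    case True
    have "?D \<subseteq> fractions ?D"
      using subringE(1,3)[OF D] by (auto intro!: fractionsI[of _ \<one>])
    then show ?thesis
      using fractions_subfield[OF D] D_incl stably_finite_transcendental_extension[OF L x True \<Gamma> fin]
      by (intro exI[of _ "fractions ?D"]) blast
  next
    case False
    then have alg: "(algebraic over L) x" by (simp add: over_def)
    let ?m = "Irr L x"
    have m: "?m \<in> carrier (L[X])" "degree ?m > 0"
      using IrrE(1)[OF L x alg] pirreducible_degree[OF L IrrE(1,2)[OF L x alg]] by auto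
    interpret S: field "Rupt L ?m" using L x alg by (rule rupture_of_Irr)
    obtain g where g: "g \<in> ring_iso (R\<lparr>carrier := ?D\<rparr>) (Rupt L ?m)"
      using ring_iso_sym[OF S.ring_axioms simple_extension_of_algebraic[OF L x alg]]
      unfolding is_ring_iso_def by blast
    then have g_hom: "g \<in> ring_hom (R\<lparr>carrier := ?D\<rparr>) (Rupt L ?m)" and g_inj: "inj_on g ?D"
      by (auto simp: ring_iso_def bij_betw_def)
    interpret g: ring_hom_ring "R\<lparr>carrier := ?D\<rparr>" "Rupt L ?m" g
      using subring_is_ring[OF D] S.ring_axioms g_hom by (rule ring_hom_ringI2)
    have "stably_finite (group_ring (R\<lparr>carrier := ?D\<rparr>) \<Gamma>)"
    proof (rule stably_finite_if_embeds[OF g.R.ring_axioms S.ring_axioms \<Gamma> g_hom])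
      show "stably_finite (group_ring (Rupt L ?m) \<Gamma>)"
        using L m \<Gamma> fin by (rule rupture_stably_finite)
      show "u = \<zero>\<^bsub>R\<lparr>carrier := ?D\<rparr>\<^esub>" if "u \<in> carrier (R\<lparr>carrier := ?D\<rparr>)" "g u = \<zero>\<^bsub>Rupt L ?m\<^esub>" for u
        using that g.hom_zero inj_onD[OF g_inj, of u \<zero>] subringE(2)[OF D] by simp
    qed
    moreover have "subfield ?D R" using simple_extension_is_subfield[OF L x] alg by simp
    ultimately show ?thesis using D_incl by blast
  qed
qed

text \<open>
Any finite set of elements can be adjoined to \<open>P\<close> one at a time, so every finite set of
coefficients lies in a subfield with stably finite group ring, where the identity map detects its
nonzero elements.
\<close>

theorem (in field) stably_finite_if_subfield:
  assumes P: "subfield P R" and \<Gamma>: "group \<Gamma>"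
    and fin: "stably_finite (group_ring (R\<lparr>carrier := P\<rparr>) \<Gamma>)"
  shows "stably_finite (group_ring R \<Gamma>)"
proof -
  have fin_gen: "\<exists>L. subfield L R \<and> C \<subseteq> L \<and> stably_finite (group_ring (R\<lparr>carrier := L\<rparr>) \<Gamma>)"
    if "finite C" "C \<subseteq> carrier R" for C
    using that
  proof (induction C rule: finite_induct)
    case empty
    then show ?case using P fin by blast
  next
    case (insert x C)
    then obtain L where L: "subfield L R" "C \<subseteq> L" "stably_finite (group_ring (R\<lparr>carrier := L\<rparr>) \<Gamma>)"
      by auto
    then show ?case using stably_finite_adjoin[OF L(1) _ \<Gamma> L(3), of x] insert by blast
  qed
  show ?thesis
  proof (rule stably_finite_if_residual_homs[OF ring_axioms \<Gamma>])
    fix C c assume C: "finite C" "C \<subseteq> carrier R" and c: "c \<in> C" "c \<noteq> \<zero>"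
    obtain L where L: "subfield L R" "C \<subseteq> L" "stably_finite (group_ring (R\<lparr>carrier := L\<rparr>) \<Gamma>)"
      using fin_gen[OF C] by blast
    have "ring (R\<lparr>carrier := L\<rparr>)" using subfieldE(1)[OF L(1)] by (rule subring_is_ring)
    then show "\<exists>D \<phi> (S :: ('a, 'b) ring_scheme). subring D R \<and> ring S \<and> \<phi> \<in> ring_hom (R\<lparr>carrier := D\<rparr>) S \<and>
        stably_finite (group_ring S \<Gamma>) \<and> C \<subseteq> D \<and> \<phi> c \<noteq> \<zero>\<^bsub>S\<^esub>"
      using L c subfieldE(1)[OF L(1)]
      by (intro exI[of _ L] exI[of _ "\<lambda>x. x"] exI[of _ "R\<lparr>carrier := L\<rparr>"])
         (auto intro!: ring_hom_memI)
  qed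
qed

section \<open>The prime subfield\<close>

text \<open>
The multiples of \<open>1\<close> that vanish are those divisible by the additive order of \<open>1\<close>, so the
greatest common divisor in the definition of the characteristic is that order.
\<close>

lemma (in ring) ring_char_multiple_of_one:
  "[ring_char R] \<cdot> \<one> = \<zero>"
proof -
  have "{n::nat. [n] \<cdot> \<one> = \<zero>} = {n. add.ord \<one> dvd n}"
    by (simp add: add.pow_eq_id)
  moreover have "Gcd {n. add.ord \<one> dvd n} = add.ord \<one>"
    by (rule Gcd_eqI) auto
  ultimately have "ring_char R = add.ord \<one>" by (simp add: ring_char_def)
  then show ?thesis by (simp add: add.pow_eq_id)
qed

lemma (in domain) int_multiple_of_one_eq_zero_iff:
  assumes p: "prime (p::nat)" and char: "[p] \<cdot> \<one> = \<zero>"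
  shows "[(k::int)] \<cdot> \<one> = \<zero> \<longleftrightarrow> int p dvd k"
proof -
  have "add.ord \<one> dvd p" using char by (simp add: add.pow_eq_id)
  moreover have "add.ord \<one> \<noteq> 1"
    using one_not_zero by (metis add.pow_eq_id dvd_refl one_closed add.nat_pow_eone add.nat_pow_0)
  ultimately have "add.ord \<one> = p" using p by (auto simp: prime_nat_iff)
  then show ?thesis using add.int_pow_eq_id[of \<one> k] by simp
qed

definition (in ring) prime_subfield :: "'a set" where
  "prime_subfield = range (\<lambda>k::int. [k] \<cdot> \<one>)"

lemma (in field) prime_subfield_is_subfield:
  assumes p: "prime (p::nat)" and char: "[p] \<cdot> \<one> = \<zero>"
  shows "subfield prime_subfield R"
proof (rule subfieldI')
  have mult: "([i] \<cdot> \<one>) \<otimes> ([j] \<cdot> \<one>) = [(i * j)] \<cdot> \<one>" for i j :: int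
    by (simp add: add_pow_ldistr_int add.int_pow_pow mult.commute)
  show "subring prime_subfield R"
  proof (rule subringI)
    show "\<one> \<in> prime_subfield"
      unfolding prime_subfield_def by (rule range_eqI[of _ _ 1]) simp
    show "prime_subfield \<subseteq> carrier R" by (auto simp: prime_subfield_def)
    fix z assume "z \<in> prime_subfield"
    then obtain i :: int where i: "z = [i] \<cdot> \<one>" by (auto simp: prime_subfield_def)
    show "\<ominus> z \<in> prime_subfield"
      unfolding prime_subfield_def i by (rule range_eqI[of _ _ "- i"]) (simp add: add.int_pow_neg)
    fix w assume "w \<in> prime_subfield"
    then obtain j :: int where j: "w = [j] \<cdot> \<one>" by (auto simp: prime_subfield_def)
    show "z \<otimes> w \<in> prime_subfield"
      unfolding prime_subfield_def i j mult by simp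
    show "z \<oplus> w \<in> prime_subfield"
      unfolding prime_subfield_def i j by (rule range_eqI[of _ _ "i + j"]) (simp add: add.int_pow_mult)
  qed
  fix z assume z: "z \<in> prime_subfield - {\<zero>}"
  then obtain i :: int where i: "z = [i] \<cdot> \<one>" by (auto simp: prime_subfield_def)
  then have "\<not> int p dvd i"
    using z int_multiple_of_one_eq_zero_iff[OF p char] by simp
  then have "coprime i (int p)"
    using p prime_imp_coprime[of "int p" i] by (simp add: coprime_commute)
  \<comment> \<open>a Bezout coefficient of \<open>i\<close> inverts \<open>[i] 1\<close>\<close>
  then obtain u v where uv: "u * i + v * int p = 1"
    using bezout_int[of i "int p"] by auto
  have "[(v * int p)] \<cdot> \<one> = \<zero>"
    using int_multiple_of_one_eq_zero_iff[OF p char] by simp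
  moreover have "[(u * i + v * int p)] \<cdot> \<one> = [(u * i)] \<cdot> \<one> \<oplus> [(v * int p)] \<cdot> \<one>"
    by (simp add: add.int_pow_mult)
  ultimately have "[(u * i)] \<cdot> \<one> = \<one>" by (simp add: uv)
  then have "([u] \<cdot> \<one>) \<otimes> z = \<one>" unfolding i mult .
  then have "inv z = [u] \<cdot> \<one>"
    using i by (intro comm_inv_char) (auto simp: m_comm)
  then show "inv z \<in> prime_subfield" by (simp add: prime_subfield_def)
qed

text \<open>
In both fields \<open>[i] 1 = [j] 1\<close> means \<open>i \<equiv> j\<close> modulo \<open>p\<close>, so \<open>[i] 1 \<mapsto> [i] 1\<close> is a well
defined and injective map.
\<close>

lemma prime_subfield_embeds:
  fixes K :: "('a, 'm) ring_scheme" and F :: "('b, 'n) ring_scheme"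
  assumes K: "field K" and F: "field F" and p: "prime (p::nat)"
    and charK: "[p] \<cdot>\<^bsub>K\<^esub> \<one>\<^bsub>K\<^esub> = \<zero>\<^bsub>K\<^esub>" and charF: "[p] \<cdot>\<^bsub>F\<^esub> \<one>\<^bsub>F\<^esub> = \<zero>\<^bsub>F\<^esub>"
  shows "\<exists>\<phi>\<in>ring_hom (K\<lparr>carrier := ring.prime_subfield K\<rparr>) F.
    \<forall>z\<in>ring.prime_subfield K. \<phi> z = \<zero>\<^bsub>F\<^esub> \<longrightarrow> z = \<zero>\<^bsub>K\<^esub>"
proof -
  interpret K: field K by fact
  interpret F: field F by fact
  let ?k = "\<lambda>i::int. [i] \<cdot>\<^bsub>K\<^esub> \<one>\<^bsub>K\<^esub>" and ?f = "\<lambda>i::int. [i] \<cdot>\<^bsub>F\<^esub> \<one>\<^bsub>F\<^esub>"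
  have eq_iff: "?k i = ?k j \<longleftrightarrow> int p dvd i - j" for i j
    using K.int_multiple_of_one_eq_zero_iff[OF p charK, of "i - j"]
    by (simp add: K.add.int_pow_diff flip: K.minus_eq)
  have eq_iff': "?f i = ?f j \<longleftrightarrow> int p dvd i - j" for i j
    using F.int_multiple_of_one_eq_zero_iff[OF p charF, of "i - j"]
    by (simp add: F.add.int_pow_diff flip: F.minus_eq)
  define \<phi> where "\<phi> z = ?f (SOME i. z = ?k i)" for z
  have \<phi>: "\<phi> (?k i) = ?f i" for i
  proof -
    have "?k i = ?k (SOME j. ?k i = ?k j)" by (rule someI[of _ i]) simp
    then show ?thesis unfolding \<phi>_def eq_iff eq_iff' by (simp add: dvd_diff_commute)
  qed
  show ?thesis
  proof (intro bexI ballI impI)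
    show "\<phi> \<in> ring_hom (K\<lparr>carrier := K.prime_subfield\<rparr>) F"
    proof (rule ring_hom_memI)
      show "\<phi> \<one>\<^bsub>K\<lparr>carrier := K.prime_subfield\<rparr>\<^esub> = \<one>\<^bsub>F\<^esub>" using \<phi>[of 1] by simp
      fix z assume "z \<in> carrier (K\<lparr>carrier := K.prime_subfield\<rparr>)"
      then obtain i where i: "z = ?k i" by (auto simp: K.prime_subfield_def)
      show "\<phi> z \<in> carrier F" by (simp add: i \<phi>)
      fix w assume "w \<in> carrier (K\<lparr>carrier := K.prime_subfield\<rparr>)"
      then obtain j where j: "w = ?k j" by (auto simp: K.prime_subfield_def)
      have "z \<otimes>\<^bsub>K\<^esub> w = ?k (i * j)"
        by (simp add: i j K.add_pow_ldistr_int K.add.int_pow_pow mult.commute)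
      moreover have "?f i \<otimes>\<^bsub>F\<^esub> ?f j = ?f (i * j)"
        by (simp add: F.add_pow_ldistr_int F.add.int_pow_pow mult.commute)
      ultimately show "\<phi> (z \<otimes>\<^bsub>K\<lparr>carrier := K.prime_subfield\<rparr>\<^esub> w) = \<phi> z \<otimes>\<^bsub>F\<^esub> \<phi> w"
        by (simp add: i j \<phi>)
      have "z \<oplus>\<^bsub>K\<^esub> w = ?k (i + j)" by (simp add: i j K.add.int_pow_mult)
      moreover have "?f i \<oplus>\<^bsub>F\<^esub> ?f j = ?f (i + j)" by (simp add: F.add.int_pow_mult)
      ultimately show "\<phi> (z \<oplus>\<^bsub>K\<lparr>carrier := K.prime_subfield\<rparr>\<^esub> w) = \<phi> z \<oplus>\<^bsub>F\<^esub> \<phi> w"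
        by (simp add: i j \<phi>)
    qed
    show "z = \<zero>\<^bsub>K\<^esub>" if z: "z \<in> K.prime_subfield" "\<phi> z = \<zero>\<^bsub>F\<^esub>" for z
    proof -
      obtain i where i: "z = ?k i" using z(1) by (auto simp: K.prime_subfield_def)
      then show ?thesis
        using z(2) \<phi> K.int_multiple_of_one_eq_zero_iff[OF p charK]
          F.int_multiple_of_one_eq_zero_iff[OF p charF] by simp
    qed
  qed
qed

theorem corollary1p8:
  fixes p :: nat
  assumes "prime p"
    and "\<exists>F :: 'f ring. field F \<and> ring_char F = p \<and> kaplansky_stable_finiteness TYPE('g) F"
  shows "\<forall>K :: 'k ring. field K \<and> ring_char K = p \<longrightarrow> kaplansky_stable_finiteness TYPE('g) K"
proof (intro allI impI)
  fix K :: "'k ring" assume K: "field K \<and> ring_char K = p"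
  obtain F :: "'f ring" where F: "field F" "ring_char F = p" "kaplansky_stable_finiteness TYPE('g) F"
    using assms(2) by blast
  interpret K: field K using K by blast
  interpret F: field F by fact
  have charK: "[p] \<cdot>\<^bsub>K\<^esub> \<one>\<^bsub>K\<^esub> = \<zero>\<^bsub>K\<^esub>" using K.ring_char_multiple_of_one K by simp
  have charF: "[p] \<cdot>\<^bsub>F\<^esub> \<one>\<^bsub>F\<^esub> = \<zero>\<^bsub>F\<^esub>" using F.ring_char_multiple_of_one F(2) by simp
  let ?P = "K.prime_subfield"
  have P: "subfield ?P K" using assms(1) charK by (rule K.prime_subfield_is_subfield)
  obtain \<phi> where \<phi>: "\<phi> \<in> ring_hom (K\<lparr>carrier := ?P\<rparr>) F"
    "\<And>z. \<lbrakk>z \<in> ?P; \<phi> z = \<zero>\<^bsub>F\<^esub>\<rbrakk> \<Longrightarrow> z = \<zero>\<^bsub>K\<^esub>"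
    using prime_subfield_embeds[OF K.field_axioms F(1) assms(1) charK charF] by blast
  show "kaplansky_stable_finiteness TYPE('g) K"
    unfolding kaplansky_stable_finiteness_def
  proof (intro allI impI)
    fix \<Gamma> :: "'g monoid" assume \<Gamma>: "group \<Gamma>"
    then have "stably_finite (group_ring F \<Gamma>)"
      using F(3) by (simp add: kaplansky_stable_finiteness_def)
    then have "stably_finite (group_ring (K\<lparr>carrier := ?P\<rparr>) \<Gamma>)"
      using \<phi> K.subring_is_ring[OF subfieldE(1)[OF P]] F.ring_axioms \<Gamma>
      by (intro stably_finite_if_embeds[where \<phi> = \<phi>]) auto
    with P \<Gamma> show "stably_finite (group_ring K \<Gamma>)"
      by (rule K.stably_finite_if_subfield)
  qed
qed

end
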